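(* Let $p\in[1,+\infty)$, $p\neq d_y/2$, and $q\in[1,+\infty]$. Suppose: (i) there is a constant $a>p$ such that $\mathbb{E}[\exp(\|\varepsilon\|^a)]<+\infty$; (ii) for every $n$ and any $\alpha\in(0,1)$ there exists a constant $\kappa_n(\alpha)>0$ such that $\mathbb P\{\sup_{x\in\mathcal X}\|f^*(x)-\hat f_n(x)\|>\kappa_n(\alpha)\}\le\alpha$; (iii) $c(\cdot,y)$ is lower semicontinuous on $\mathcal Z$ for each $y\in\mathcal Y$, $c(z,\cdot)$ is continuous on $\mathcal Y$ for each $z\in\mathcal Z$, and there is a constant $B_{c,p}\ge0$ with $|c(z,y)|\le B_{c,p}(1+\|y\|^p)$ for all $z\in\mathcal Z$, $y\in\mathcal Y$; (iv) the sequence of risk levels $\{\alpha_n\}\subset(0,1)$ satisfies $\sum_n\alpha_n<\infty$ and $\lim_{n\to\infty}\zeta_n(\alpha_n)=0$, with the covariate-independent radius $\zeta_n(\cdot)$ defined in the context; (v) the samples $\{\varepsilon^i\}_{i=1}^n$ are i.i.d.; (vi) with $z^*(x)\in S^*(x)$ an optimal solution of the true problem, at least one of the following holds: (A) for each $z\in\mathcal Z$, $c(z,\cdot)$ is Lipschitz continuous on $\mathcal Y$ with Lipschitz constant $L_1(z)$, and $\|L_1(z^*(\cdot))\|_{L^q}<+\infty$; or (B) $p\ge2$ and, for each $z\in\mathcal Z$, $c(z,\cdot)$ is differentiable on $\mathcal Y$ with $\mathbb E[\|\nabla c(z,f^*(x)+\varepsilon)\|^2]<+\infty$ for a.e. $x\in\mathcal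 X$ and $\|\nabla c(z,\bar y)-\nabla c(z,y)\|\le L_2(z)\|\bar y-y\|$ for all $y,\bar y\in\mathcal Y$ (gradients in the second argument), and moreover the function $x\mapsto\big(\mathbb E[\|\nabla c(z^*(x),f^*(x)+\varepsilon)\|^2]\big)^{1/2}$ (expectation over $\varepsilon$) has finite $L^q$-norm and $\|L_2(z^*(\cdot))\|_{L^q}<+\infty$. Then the Wasserstein ER-DRO problem with ambiguity set $\hat{\mathcal P}_n(x;\zeta_n(\alpha_n))$ satisfies $$\|\hat v^{DRO}_n(X)-v^*(X)\|_{L^q}=O_p(\zeta_n(\alpha_n)),\qquad \|g(\hat z^{DRO}_n(X);X)-v^*(X)\|_{L^q}=O_p(\zeta_n(\alpha_n)).$$
   Context: Setup. $Y=f^*(X)+\varepsilon$, where $X$ is a random vector with support $\mathcal X\subseteq\mathbb R^{d_x}$ and distribution $P_X$, $Y$ has nonempty convex support $\mathcal Y\subseteq\mathbb R^{d_y}$, $f^*(x):=\mathbb E[Y\mid X=x]$, and the zero-mean error $\varepsilon$ (distribution $P_\varepsilon$) is independent of $X$. $P_{Y\mid X=x}$ is the conditional distribution of $Y$ given $X=x$, i.e. the law of $f^*(x)+\varepsilon$. "A.e. $x$" is with respect to $P_X$. $\|\cdot\|$ is the Euclidean norm; $\|\cdot\|_{L^q}$ is the $L^q$-norm of functions on $\mathcal X$ with respect to $P_X$ (for a fixed realization of the data when the function depends on the data). $\mathcal Z\subseteq\mathbb R^{d_z}$ is nonempty and compact, $c:\mathcal Z\times\mathcal Y\to\mathbb R$,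 $\mathbb E|c(z,f^*(x)+\varepsilon)|<\infty$ for each $z\in\mathcal Z$ and a.e. $x$, and $g(z;x):=\mathbb E[c(z,f^*(x)+\varepsilon)]$ is lower semicontinuous in $z$ on $\mathcal Z$ for a.e. $x$. The true problem is $v^*(x):=\min_{z\in\mathcal Z}g(z;x)$ with set of optimal solutions $S^*(x)$. All functions, sets and selections are assumed measurable. Data. $\mathcal D_n=\{(y^i,x^i)\}_{i=1}^n$ are joint observations of $(Y,X)$, $\varepsilon^i:=y^i-f^*(x^i)$; $\hat f_n$ is an estimate of $f^*$ built from $\mathcal D_n$ by a regression method, with residuals $\hat\varepsilon^i_n:=y^i-\hat f_n(x^i)$. Probabilities $\mathbb P$ refer to the data; $V_n=O_p(W_n)$ means $V_n=R_nW_n$ with $\{R_n\}$ bounded in probability. With $\mathrm{proj}_{\mathcal Y}$ the orthogonal projection onto $\mathcal Y$ and $\delta$ the Dirac measure, $$P^*_n(x):=\tfrac1n\sum_{i=1}^n\delta_{f^*(x)+\varepsilon^i},\qquad \hat P^{ER}_n(x):=\tfrac1n\sum_{i=1}^n\delta_{\mathrm{proj}_{\mathcal Y}(\hat f_n(x)+\hat\varepsilon^i_n)} .$$ Wasserstein ER-DRO. $\mathcal P(\mathcal Y)$ is the set of probability distributions supported in $\mathcal Y$; $d_{W,p}(Q_1,Q_2):=\big(\inf_\pi\int\|y_1-y_2\|^p\,d\pi\big)^{1/p}$, infimum over couplings $\pi$ of $Q_1,Q_2$. For $\zeta\ge0$, $\hat{\mathcal P}_n(x;\zeta):=\{Q\in\mathcal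 P(\mathcal Y): d_{W,p}(Q,\hat P^{ER}_n(x))\le\zeta\}$. The ER-DRO problem is $\hat v^{DRO}_n(x)=\min_{z\in\mathcal Z}\sup_{Q\in\hat{\mathcal P}_n(x;\zeta)}\mathbb E_{Y\sim Q}[c(z,Y)]$, whose objective is assumed real-valued and lower semicontinuous on $\mathcal Z$ for each $x$; $\hat z^{DRO}_n(x)$ denotes an optimal solution. Radius. Let $C\ge1$, $c_0>0$ be the constants (depending only on $a$, $d_y$ and $\mathbb E[\exp(\|\varepsilon\|^a)]$) of the measure concentration inequality, quoted from the literature, $$\mathbb P\{d_{W,p}(P^*_n(x),P_{Y\mid X=x})\ge\kappa\}\le\begin{cases}C\exp(-c_0n\kappa^{\max\{d_y/p,2\}}),&\kappa\le1,\\ C\exp(-c_0n\kappa^{a/p}),&\kappa>1,\end{cases}$$ for all $\kappa>0$, $n\in\mathbb N$, $x\in\mathcal X$. Setting the right-hand side equal to $\alpha/2$ gives $$\kappa^{(2)}_{p,n}(\alpha):=\begin{cases}\big(\tfrac{\log(2C/\alpha)}{c_0n}\big)^{\min\{p/d_y,1/2\}},&n\ge\log(2C/\alpha)/c_0,\\ \big(\tfrac{\log(2C/\alpha)}{c_0n}\big)^{p/a},&n<\log(2C/\alpha)/c_0.\end{cases}$$ The covariate-independent radius is $\zeta_n(\alpha):=2\kappa_n(\alpha/4)+\kappa^{(2)}_{p,n}(\alpha)$, where $\kappa_n$ is the constant in hypothesis (ii) of the claim. *)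

theory Defs
  imports "HOL-Probability.Probability"
begin

definition msupport :: "'a::topological_space measure \<Rightarrow> 'a set" where
  "msupport P = {x. \<forall>U. open U \<longrightarrow> x \<in> U \<longrightarrow> emeasure P U > 0}"

lemma closed_msupport: "closed (msupport P)"
proof -
  have "msupport P = - \<Union>{U. open U \<and> emeasure P U = 0}"
    unfolding msupport_def by (auto simp: zero_less_iff_neq_zero)
  then show ?thesis by (auto simp: closed_def)
qed

definition lsc_on :: "'a::topological_space set \<Rightarrow> ('a \<Rightarrow> real) \<Rightarrow> bool" where
  "lsc_on S h \<longleftrightarrow> (\<forall>x\<in>S. \<forall>t<h x. \<forall>\<^sub>F y in at x within S. t < h y)"

text \<open>Only used for exponents \<open>r > 0\<close>, where the value \<open>\<top>\<close> at \<open>\<top>\<close> is the usual convention.\<close>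

definition epowr :: "ennreal \<Rightarrow> real \<Rightarrow> ennreal" where
  "epowr t r = (if t = \<top> then \<top> else ennreal (enn2real t powr r))"

text \<open>Norms are taken of \<open>[0,\<infinity>]\<close>-valued functions, so that no finiteness is built in;
  a real function \<open>h\<close> is passed as \<open>\<lambda>x. ennreal \<bar>h x\<bar>\<close>.\<close>

definition Lq_norm :: "'a measure \<Rightarrow> ennreal \<Rightarrow> ('a \<Rightarrow> ennreal) \<Rightarrow> ennreal" where
  "Lq_norm P q h =
     (if q = \<top> then esssup P h
      else epowr (\<integral>\<^sup>+x. epowr (h x) (enn2real q) \<partial>P) (1 / enn2real q))"

definition finite_Lq :: "'a measure \<Rightarrow> ennreal \<Rightarrow> ('a \<Rightarrow> ennreal) \<Rightarrow> bool" where
  "finite_Lq P q h \<longleftrightarrow> h \<in> borel_measurable P \<and> Lq_norm P q h < \<top>"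

text \<open>The variables may take the value \<open>\<infinity>\<close> (an \<open>L\<^sup>q\<close>-norm may be infinite for small \<open>n\<close>), so
  boundedness in probability is required for all large \<open>n\<close>. For a sequence of real-valued
  random variables this is the same as boundedness for all \<open>n\<close>, since finitely many of them are
  always tight. Sequences are indexed by the sample size \<open>n \<ge> 1\<close>.\<close>

definition bounded_in_prob :: "'w measure \<Rightarrow> (nat \<Rightarrow> 'w \<Rightarrow> ennreal) \<Rightarrow> bool" where
  "bounded_in_prob M R \<longleftrightarrow>
     (\<forall>n\<ge>1. R n \<in> borel_measurable M) \<and>
     (\<forall>\<delta>>0. \<exists>K::real. \<forall>\<^sub>F n in sequentially.
        measure M {\<omega> \<in> space M. R n \<omega> > ennreal K} \<le> \<delta>)"

definition bigOp :: "'w measure \<Rightarrow> (nat \<Rightarrow> 'w \<Rightarrow> ennreal) \<Rightarrow> (nat \<Rightarrow> real) \<Rightarrow> bool" where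
  "bigOp M V W \<longleftrightarrow>
     (\<exists>R. bounded_in_prob M R \<and> (\<forall>n\<ge>1. \<forall>\<omega>\<in>space M. V n \<omega> = R n \<omega> * ennreal (W n)))"

definition couplings :: "'b::euclidean_space measure \<Rightarrow> 'b measure \<Rightarrow> ('b \<times> 'b) measure set" where
  "couplings Q1 Q2 = {\<pi>. prob_space \<pi> \<and> sets \<pi> = sets (borel \<Otimes>\<^sub>M borel) \<and>
     distr \<pi> borel fst = Q1 \<and> distr \<pi> borel snd = Q2}"

definition wasserstein :: "real \<Rightarrow> 'b::euclidean_space measure \<Rightarrow> 'b measure \<Rightarrow> ennreal" where
  "wasserstein p Q1 Q2 =
     epowr (INF \<pi>\<in>couplings Q1 Q2. \<integral>\<^sup>+y. ennreal (norm (fst y - snd y) powr p) \<partial>\<pi>) (1 / p)"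

definition prob_measures_on :: "'b::topological_space set \<Rightarrow> 'b measure set" where
  "prob_measures_on S = {Q. prob_space Q \<and> sets Q = sets borel \<and> (AE y in Q. y \<in> S)}"

definition wasserstein_ball ::
    "real \<Rightarrow> 'b::euclidean_space set \<Rightarrow> 'b measure \<Rightarrow> real \<Rightarrow> 'b measure set" where
  "wasserstein_ball p S P \<zeta> = {Q \<in> prob_measures_on S. wasserstein p Q P \<le> ennreal \<zeta>}"

definition empirical :: "nat \<Rightarrow> (nat \<Rightarrow> 'b::topological_space) \<Rightarrow> 'b measure" where
  "empirical n pt = distr (uniform_count_measure {1..n}) borel pt"

definition cond_law ::
    "'w measure \<Rightarrow> ('x \<Rightarrow> 'y::euclidean_space) \<Rightarrow> ('w \<Rightarrow> 'y) \<Rightarrow> 'x \<Rightarrow> 'y measure" where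
  "cond_law M f \<epsilon> x = distr M borel (\<lambda>\<omega>. f x + \<epsilon> \<omega>)"

text \<open>The library's \<open>indep_var\<close> needs both variables to have the same type.\<close>

definition indep_rvs ::
    "'w measure \<Rightarrow> ('w \<Rightarrow> 'a::topological_space) \<Rightarrow> ('w \<Rightarrow> 'b::topological_space) \<Rightarrow> bool" where
  "indep_rvs M U V \<longleftrightarrow>
     U \<in> borel_measurable M \<and> V \<in> borel_measurable M \<and>
     prob_space.indep_set M
       (sets (vimage_algebra (space M) U borel)) (sets (vimage_algebra (space M) V borel))"

text \<open>If \<open>Y = f X + \<epsilon>\<close> with \<open>\<epsilon>\<close> of mean zero and independent of \<open>X\<close>, then \<open>cond_law M f \<epsilon> x\<close> is the
  conditional distribution of \<open>Y\<close> given \<open>X = x\<close>, and \<open>f x\<close> is its mean \<open>E[Y | X = x]\<close>.\<close>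

lemma cond_law_mean:
  assumes "prob_space M" "integrable M \<epsilon>" "(LINT \<omega>|M. \<epsilon> \<omega>) = 0"
  shows "f x = (LINT y|cond_law M f \<epsilon> x. y)"
proof -
  interpret prob_space M by fact
  have [measurable]: "\<epsilon> \<in> borel_measurable M" using assms(2) by auto
  have "(LINT y|cond_law M f \<epsilon> x. y) = (LINT \<omega>|M. f x + \<epsilon> \<omega>)"
    unfolding cond_law_def by (subst integral_distr) auto
  then show ?thesis using assms by (simp add: prob_space)
qed

lemma cond_law_disintegration:
  fixes f :: "'x::euclidean_space \<Rightarrow> 'y::euclidean_space"
  assumes "prob_space M" and ind: "indep_rvs M X \<epsilon>"
    and [measurable]: "f \<in> borel_measurable borel" "A \<in> sets borel" "B \<in> sets borel"
  shows "emeasure M {\<omega> \<in> space M. X \<omega> \<in> A \<and> f (X \<omega>) + \<epsilon> \<omega> \<in> B} =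
    (\<integral>\<^sup>+x\<in>A. emeasure (cond_law M f \<epsilon> x) B \<partial>distr M borel X)"
proof -
  interpret prob_space M by fact
  have [measurable]: "X \<in> borel_measurable M" "\<epsilon> \<in> borel_measurable M"
    using ind by (auto simp: indep_rvs_def)
  let ?P = "distr M borel X" and ?E = "distr M borel \<epsilon>"
  interpret E: prob_space ?E by (rule prob_space_distr) simp
  interpret P: prob_space ?P by (rule prob_space_distr) simp
  let ?S = "{u. fst u \<in> A \<and> f (fst u) + snd u \<in> B} :: ('x \<times> 'y) set"
  have "{u \<in> space (borel \<Otimes>\<^sub>M borel). fst u \<in> A \<and> f (fst u) + snd u \<in> B}
      \<in> sets ((borel :: 'x measure) \<Otimes>\<^sub>M (borel :: 'y measure))" by measurable
  then have S: "?S \<in> sets (borel \<Otimes>\<^sub>M borel)" by (simp add: space_pair_measure)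
  have eq: "distr M (borel \<Otimes>\<^sub>M borel) (\<lambda>\<omega>. (X \<omega>, \<epsilon> \<omega>)) = ?P \<Otimes>\<^sub>M ?E"
  proof (rule pair_measure_eqI[symmetric])
    show "sets (?P \<Otimes>\<^sub>M ?E) = sets (distr M (borel \<Otimes>\<^sub>M borel) (\<lambda>\<omega>. (X \<omega>, \<epsilon> \<omega>)))"
      unfolding sets_distr by (rule sets_pair_measure_cong) simp_all
    fix U V assume "U \<in> sets ?P" "V \<in> sets ?E"
    then have [measurable]: "U \<in> sets borel" "V \<in> sets borel" by auto
    have "prob ((X -` U \<inter> space M) \<inter> (\<epsilon> -` V \<inter> space M))
        = prob (X -` U \<inter> space M) * prob (\<epsilon> -` V \<inter> space M)"
      using ind by (intro indep_setD) (auto simp: indep_rvs_def intro!: in_vimage_algebra)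
    moreover have "(\<lambda>\<omega>. (X \<omega>, \<epsilon> \<omega>)) -` (U \<times> V) \<inter> space M
        = (X -` U \<inter> space M) \<inter> (\<epsilon> -` V \<inter> space M)" by auto
    ultimately show "emeasure ?P U * emeasure ?E V =
        emeasure (distr M (borel \<Otimes>\<^sub>M borel) (\<lambda>\<omega>. (X \<omega>, \<epsilon> \<omega>))) (U \<times> V)"
      by (simp add: emeasure_distr emeasure_eq_measure ennreal_mult)
  qed (simp_all add: P.sigma_finite_measure_axioms E.sigma_finite_measure_axioms)
  have "emeasure M {\<omega> \<in> space M. X \<omega> \<in> A \<and> f (X \<omega>) + \<epsilon> \<omega> \<in> B} =
      emeasure (distr M (borel \<Otimes>\<^sub>M borel) (\<lambda>\<omega>. (X \<omega>, \<epsilon> \<omega>))) ?S"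
    using S by (subst emeasure_distr) (auto intro!: arg_cong[where f = "emeasure M"])
  also have "\<dots> = (\<integral>\<^sup>+x. emeasure ?E (Pair x -` ?S) \<partial>?P)"
  proof -
    have "sets (?P \<Otimes>\<^sub>M ?E) = sets (borel \<Otimes>\<^sub>M borel)"
      by (rule sets_pair_measure_cong) simp_all
    with S show ?thesis unfolding eq by (intro E.emeasure_pair_measure_alt) simp
  qed
  also have "\<dots> = (\<integral>\<^sup>+x\<in>A. emeasure (cond_law M f \<epsilon> x) B \<partial>?P)"
  proof (rule nn_integral_cong)
    fix x
    have "{e. f x + e \<in> B} \<in> sets borel" by measurable
    then show "emeasure ?E (Pair x -` ?S) = emeasure (cond_law M f \<epsilon> x) B * indicator A x"
      unfolding cond_law_def
      by (cases "x \<in> A") (auto simp: emeasure_distr vimage_def)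
  qed
  finally show ?thesis .
qed

text \<open>A data set of size \<open>n\<close> is a function \<open>d\<close> on \<open>{1..n}\<close> with \<open>d i = (y\<^sup>i, x\<^sup>i)\<close>; a regression
  method \<open>F n\<close> maps it to a function of the covariates.\<close>

definition dataset :: "(nat \<Rightarrow> 'w \<Rightarrow> 'y) \<Rightarrow> (nat \<Rightarrow> 'w \<Rightarrow> 'x) \<Rightarrow> nat \<Rightarrow> 'w \<Rightarrow> nat \<Rightarrow> 'y \<times> 'x" where
  "dataset ys xs n \<omega> = (\<lambda>i\<in>{1..n}. (ys i \<omega>, xs i \<omega>))"

definition residual ::
    "(nat \<Rightarrow> (nat \<Rightarrow> 'y \<times> 'x) \<Rightarrow> 'x \<Rightarrow> 'y) \<Rightarrow> nat \<Rightarrow> (nat \<Rightarrow> 'y \<times> 'x) \<Rightarrow> nat \<Rightarrow> 'y::euclidean_space" where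
  "residual F n d i = fst (d i) - F n d (snd (d i))"

definition ER_empirical ::
    "'y::euclidean_space set \<Rightarrow> (nat \<Rightarrow> (nat \<Rightarrow> 'y \<times> 'x) \<Rightarrow> 'x \<Rightarrow> 'y) \<Rightarrow> nat \<Rightarrow> (nat \<Rightarrow> 'y \<times> 'x) \<Rightarrow>
      'x \<Rightarrow> 'y measure" where
  "ER_empirical Ysp F n d x = empirical n (\<lambda>i. closest_point Ysp (F n d x + residual F n d i))"

definition expected_cost ::
    "('z \<Rightarrow> 'y \<Rightarrow> real) \<Rightarrow> 'y set \<Rightarrow> 'z \<Rightarrow> 'y measure \<Rightarrow> real" where
  "expected_cost c Ysp z Q = (LINT y:Ysp|Q. c z y)"

definition worst_case_cost ::
    "('z \<Rightarrow> 'y \<Rightarrow> real) \<Rightarrow> 'y set \<Rightarrow> 'y measure set \<Rightarrow> 'z \<Rightarrow> real" where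
  "worst_case_cost c Ysp \<Q> z = (SUP Q\<in>\<Q>. expected_cost c Ysp z Q)"

definition conc_bound ::
    "real \<Rightarrow> real \<Rightarrow> nat \<Rightarrow> real \<Rightarrow> real \<Rightarrow> nat \<Rightarrow> real \<Rightarrow> real" where
  "conc_bound p a dy C c0 n \<kappa> =
     (if \<kappa> \<le> 1 then C * exp (- c0 * real n * \<kappa> powr max (real dy / p) 2)
      else C * exp (- c0 * real n * \<kappa> powr (a / p)))"

definition kappa2 ::
    "real \<Rightarrow> real \<Rightarrow> nat \<Rightarrow> real \<Rightarrow> real \<Rightarrow> nat \<Rightarrow> real \<Rightarrow> real" where
  "kappa2 p a dy C c0 n \<alpha> =
     (if real n \<ge> ln (2 * C / \<alpha>) / c0
      then (ln (2 * C / \<alpha>) / (c0 * real n)) powr min (p / real dy) (1 / 2)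
      else (ln (2 * C / \<alpha>) / (c0 * real n)) powr (p / a))"

definition radius ::
    "(nat \<Rightarrow> real \<Rightarrow> real) \<Rightarrow> real \<Rightarrow> real \<Rightarrow> nat \<Rightarrow> real \<Rightarrow> real \<Rightarrow> nat \<Rightarrow> real \<Rightarrow> real" where
  "radius \<kappa> p a dy C c0 n \<alpha> = 2 * \<kappa> n (\<alpha> / 4) + kappa2 p a dy C c0 n \<alpha>"

end

theory Submission
  imports Defs
begin

text \<open>Both \<open>P*\<^sub>n(x)\<close> and \<open>P\<^sub>Y\<^sub>|\<^sub>X\<^sub>=\<^sub>x\<close> are translates, by the same vector, of measures that do not depend on
  \<open>x\<close>, so a single event of probability at least \<open>1 - \<alpha>\<^sub>n / 2\<close> bounds their distance by \<open>\<kappa>\<^sup>(\<^sup>2\<^sup>)\<close>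
  for all \<open>x\<close>. The atoms of the residual-based estimator are within \<open>2 \<kappa>\<^sub>n(\<alpha>\<^sub>n / 4)\<close> of those of
  \<open>P*\<^sub>n(x)\<close>, since projections are nonexpansive. Hence, off an event of probability at most
  \<open>3 \<alpha>\<^sub>n / 4\<close>, the true conditional law lies in the ambiguity set for almost every \<open>x\<close>, and then
  \<open>v* \<le> g(z\<^sup>D\<^sup>R\<^sup>O) \<le> v\<^sup>D\<^sup>R\<^sup>O \<le> sup\<^sub>Q E\<^sub>Q c(z*, Y)\<close>. By (A), or by (B) and the mean value theorem, the
  right-hand side exceeds \<open>v*\<close> by at most \<open>H(x) \<zeta>\<^sub>n\<close> for a function \<open>H\<close> of finite \<open>L\<^sup>q\<close>-norm. As
  \<open>\<alpha>\<^sub>n \<rightarrow> 0\<close>, this gives both rates. Constants are irrelevant for the order in probability, so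
  lower moments of the transport cost are bounded crudely rather than by Jensen's inequality.\<close>

subsection \<open>Powers and norms of extended nonnegative functions\<close>

lemma epowr_ennreal: "0 \<le> r \<Longrightarrow> epowr (ennreal r) s = ennreal (r powr s)"
  by (simp add: epowr_def)

lemma epowr_top [simp]: "epowr \<top> s = \<top>"
  by (simp add: epowr_def)

lemma epowr_less_top_iff: "epowr t s < \<top> \<longleftrightarrow> t < \<top>"
  by (simp add: epowr_def less_top)

lemma epowr_mono:
  assumes "t \<le> u" "0 \<le> s" shows "epowr t s \<le> epowr u s"
  using assms by (cases t; cases u) (auto simp: epowr_ennreal top_unique intro!: ennreal_leI powr_mono2)

lemma epowr_mult:
  assumes "0 < k" shows "epowr (t * ennreal k) s = epowr t s * ennreal (k powr s)"
proof (cases t)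
  case (real r)
  then have "epowr (t * ennreal k) s = epowr (ennreal (r * k)) s" using assms by (simp add: ennreal_mult)
  also have "\<dots> = ennreal ((r * k) powr s)" using real assms by (intro epowr_ennreal) auto
  finally show ?thesis using real assms by (simp add: epowr_ennreal powr_mult ennreal_mult)
qed (use assms in \<open>simp add: ennreal_top_mult\<close>)

lemma borel_measurable_epowr [measurable]:
  assumes [measurable]: "f \<in> borel_measurable M"
  shows "(\<lambda>x. epowr (f x) s) \<in> borel_measurable M"
  unfolding epowr_def by measurable

lemma enn2real_ge_1: "1 \<le> q \<Longrightarrow> q \<noteq> \<top> \<Longrightarrow> 1 \<le> enn2real q"
  by (cases q) auto

text \<open>Monotonicity and positive homogeneity in one step, the form in which an a.e. bound
  \<open>H x * \<zeta>\<close> passes to the norms. For a finite exponent \<open>r\<close> the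
  factor leaves the integral as \<open>k powr r\<close>, and the root returns
  \<open>k\<close>.\<close>

lemma Lq_norm_le_mult:
  assumes q: "1 \<le> q" and [measurable]: "f \<in> borel_measurable P" "h \<in> borel_measurable P"
    and k: "0 < k" and le: "AE x in P. f x \<le> h x * ennreal k"
  shows "Lq_norm P q f \<le> Lq_norm P q h * ennreal k"
proof (cases "q = \<top>")
  case True
  have "AE x in P. f x \<le> esssup P h * ennreal k"
    using le esssup_AE[of h P] by eventually_elim (meson mult_right_mono order.trans zero_le)
  then have "esssup P f \<le> esssup P h * ennreal k" by (intro esssup_I) auto
  with True show ?thesis by (simp add: Lq_norm_def)
next
  case False
  define r where "r = enn2real q"
  have r: "1 \<le> r" unfolding r_def using q False by (rule enn2real_ge_1)
  have "(\<integral>\<^sup>+x. epowr (f x) r \<partial>P) \<le> (\<integral>\<^sup>+x. epowr (h x) r * ennreal (k powr r) \<partial>P)"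
    using le r k
    by (intro nn_integral_mono_AE) (auto elim!: eventually_mono simp: epowr_mult[symmetric] intro!: epowr_mono)
  also have "\<dots> = (\<integral>\<^sup>+x. epowr (h x) r \<partial>P) * ennreal (k powr r)"
    by (rule nn_integral_multc) auto
  finally have "epowr (\<integral>\<^sup>+x. epowr (f x) r \<partial>P) (1 / r) \<le>
      epowr ((\<integral>\<^sup>+x. epowr (h x) r \<partial>P) * ennreal (k powr r)) (1 / r)"
    using r by (intro epowr_mono) auto
  also have "\<dots> = epowr (\<integral>\<^sup>+x. epowr (h x) r \<partial>P) (1 / r) * ennreal k"
    using r k by (simp add: epowr_mult powr_powr)
  finally show ?thesis using False by (simp add: Lq_norm_def r_def)
qed

lemma finite_Lq_cmult:
  assumes "1 \<le> q" "finite_Lq P q h" "0 < k"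
  shows "finite_Lq P q (\<lambda>x. h x * ennreal k)"
proof -
  have [measurable]: "h \<in> borel_measurable P" and "Lq_norm P q h < \<top>"
    using assms by (auto simp: finite_Lq_def)
  moreover have "Lq_norm P q (\<lambda>x. h x * ennreal k) \<le> Lq_norm P q h * ennreal k"
    using assms by (intro Lq_norm_le_mult) auto
  ultimately show ?thesis
    unfolding finite_Lq_def by (auto simp: ennreal_mult_less_top elim!: order.strict_trans1)
qed

text \<open>The sum is at most twice the larger term, and the power of the larger term is one of the
  two summands on the right.\<close>

lemma epowr_add_le:
  assumes "0 \<le> s" shows "epowr (t + u) s \<le> (epowr t s + epowr u s) * ennreal (2 powr s)"
proof -
  have "t + u \<le> max t u * ennreal 2"
    by (cases "t \<le> u") (auto simp: max_def mult_2_right add_mono)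
  then have "epowr (t + u) s \<le> epowr (max t u * ennreal 2) s"
    using assms by (rule epowr_mono)
  also have "\<dots> = epowr (max t u) s * ennreal (2 powr s)" by (rule epowr_mult) simp
  also have "\<dots> \<le> (epowr t s + epowr u s) * ennreal (2 powr s)"
    by (intro mult_right_mono) (auto simp: max_def)
  finally show ?thesis .
qed

text \<open>Serves to add the gradient norm and the smoothness constant of case (B). For finite
  \<open>q\<close> the bound \<open>epowr_add_le\<close> carries finiteness of the two integrals
  over to the sum; for \<open>q = \<top>\<close> the essential suprema add.\<close>

lemma finite_Lq_add:
  assumes q: "1 \<le> q" and f: "finite_Lq P q f" and h: "finite_Lq P q h"
  shows "finite_Lq P q (\<lambda>x. f x + h x)"
proof -
  have [measurable]: "f \<in> borel_measurable P" "h \<in> borel_measurable P"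
    using f h by (auto simp: finite_Lq_def)
  have "Lq_norm P q (\<lambda>x. f x + h x) < \<top>"
  proof (cases "q = \<top>")
    case True
    have "AE x in P. f x + h x \<le> esssup P f + esssup P h"
      using esssup_AE[of f P] esssup_AE[of h P] by eventually_elim (rule add_mono)
    then have "esssup P (\<lambda>x. f x + h x) \<le> esssup P f + esssup P h" by (intro esssup_I) auto
    also have "\<dots> < \<top>" using f h True by (simp add: finite_Lq_def Lq_norm_def)
    finally show ?thesis using True by (simp add: Lq_norm_def)
  next
    case False
    define r where "r = enn2real q"
    have r: "1 \<le> r" unfolding r_def using q False by (rule enn2real_ge_1)
    have "(\<integral>\<^sup>+x. epowr (f x + h x) r \<partial>P) \<le>
        (\<integral>\<^sup>+x. (epowr (f x) r + epowr (h x) r) * ennreal (2 powr r) \<partial>P)"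
      using r by (intro nn_integral_mono epowr_add_le) auto
    also have "\<dots> = ((\<integral>\<^sup>+x. epowr (f x) r \<partial>P) + (\<integral>\<^sup>+x. epowr (h x) r \<partial>P)) * ennreal (2 powr r)"
      by (simp add: nn_integral_multc nn_integral_add)
    also have "\<dots> < \<top>"
      using f h False r
      by (auto simp: finite_Lq_def Lq_norm_def epowr_less_top_iff r_def ennreal_mult_less_top)
    finally show ?thesis using False by (simp add: Lq_norm_def epowr_less_top_iff r_def)
  qed
  then show ?thesis by (simp add: finite_Lq_def)
qed

text \<open>Makes the norm of a data-dependent function a random variable. For finite
  \<open>q\<close> this is measurability of an integral in its parameter. For
  \<open>q = \<top>\<close>, the essential supremum exceeds \<open>u\<close> exactly when a section
  of the superlevel set has positive measure, and section measures are measurable.\<close>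

lemma borel_measurable_Lq_norm:
  assumes "prob_space P" and h[measurable]: "(\<lambda>(\<omega>, x). h \<omega> x) \<in> borel_measurable (M \<Otimes>\<^sub>M P)"
  shows "(\<lambda>\<omega>. Lq_norm P q (h \<omega>)) \<in> borel_measurable M"
proof (cases "q = \<top>")
  case True
  interpret prob_space P by fact
  have "{\<omega> \<in> space M. u < esssup P (h \<omega>)} \<in> sets M" for u
  proof -
    have "{\<omega> \<in> space M. u < esssup P (h \<omega>)} =
        {\<omega> \<in> space M. emeasure P (Pair \<omega> -` {v \<in> space (M \<Otimes>\<^sub>M P). u < h (fst v) (snd v)}) > 0}"
      (is "?L = ?R")
    proof (intro Collect_cong conj_cong refl)
      fix \<omega> assume \<omega>: "\<omega> \<in> space M"
      then have [measurable]: "h \<omega> \<in> borel_measurable P"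
        using measurable_Pair2[OF h] by simp
      have eq: "Pair \<omega> -` {v \<in> space (M \<Otimes>\<^sub>M P). u < h (fst v) (snd v)} = {x \<in> space P. u < h \<omega> x}"
        using \<omega> by (auto simp: space_pair_measure)
      have "esssup P (h \<omega>) \<le> u \<longleftrightarrow> (AE x in P. h \<omega> x \<le> u)"
        using esssup_AE[of "h \<omega>" P] by (auto intro: esssup_I elim!: eventually_mono)
      also have "\<dots> \<longleftrightarrow> emeasure P {x \<in> space P. u < h \<omega> x} = 0"
        by (simp add: AE_iff_measurable[OF _ refl] not_le)
      finally show "u < esssup P (h \<omega>) \<longleftrightarrow>
          0 < emeasure P (Pair \<omega> -` {v \<in> space (M \<Otimes>\<^sub>M P). u < h (fst v) (snd v)})"
        unfolding eq by (metis not_le zero_less_iff_neq_zero)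
    qed
    moreover have "{v \<in> space (M \<Otimes>\<^sub>M P). u < h (fst v) (snd v)} \<in> sets (M \<Otimes>\<^sub>M P)"
      using h by (simp add: case_prod_beta')
    from measurable_emeasure_Pair[OF this]
    have "?R \<in> sets M" by measurable
    ultimately show ?thesis by (rule subst[OF sym])
  qed
  then have "(\<lambda>\<omega>. esssup P (h \<omega>)) \<in> borel_measurable M"
    by (intro borel_measurableI_greater) auto
  with True show ?thesis by (simp add: Lq_norm_def)
next
  case False
  interpret prob_space P by fact
  show ?thesis using False unfolding Lq_norm_def by simp
qed

subsection \<open>Wasserstein distance to an empirical measure\<close>

text \<open>The complement of the support is a union of open null sets; the Lindelof property leaves
  countably many of them, so the union is null.\<close>

lemma AE_msupport:
  fixes P :: "'a::second_countable_topology measure"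
  assumes "sets P = sets borel" shows "AE x in P. x \<in> msupport P"
proof -
  obtain F where F: "F \<subseteq> {U. open U \<and> emeasure P U = 0}" "countable F"
      "\<Union>F = \<Union>{U. open U \<and> emeasure P U = 0}"
    using Lindelof[of "{U. open U \<and> emeasure P U = 0}"] by auto
  have "U \<in> null_sets P" if "U \<in> F" for U
    using that F(1) assms by (auto intro!: null_setsI)
  then have "\<Union>F \<in> null_sets P"
    using null_sets_UN'[of F "\<lambda>U. U" P] F(2) by simp
  moreover have "{x \<in> space P. x \<notin> msupport P} \<subseteq> \<Union>F"
    unfolding F(3) msupport_def by (auto simp: zero_less_iff_neq_zero)
  ultimately show ?thesis by (rule AE_I')
qed

section \<open>Integration against empirical measures\<close>

lemma sets_empirical [simp, measurable_cong]: "sets (empirical n a) = sets borel"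
  by (simp add: empirical_def)

lemma space_empirical [simp]: "space (empirical n a) = UNIV"
  by (simp add: empirical_def)

lemma measurable_uniform_count_measure [simp]:
  "f \<in> measurable (uniform_count_measure A) borel"
  by (simp add: measurable_def space_uniform_count_measure sets_uniform_count_measure)

lemma prob_space_empirical: "n \<ge> 1 \<Longrightarrow> prob_space (empirical n a)"
  unfolding empirical_def
  by (intro prob_space.prob_space_distr prob_space_uniform_count_measure) auto

lemma nn_integral_empirical:
  assumes [measurable]: "f \<in> borel_measurable borel"
  shows "(\<integral>\<^sup>+y. f y \<partial>empirical n a) = (\<Sum>i\<in>{1..n}. ennreal (1 / real n) * f (a i))"
  unfolding empirical_def
  by (subst nn_integral_distr)
     (auto simp: uniform_count_measure_def nn_integral_point_measure_finite)

lemma emeasure_empirical: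
  assumes "A \<in> sets borel"
  shows "emeasure (empirical n a) A = (\<Sum>i\<in>{1..n}. ennreal (1 / real n) * indicator A (a i))"
  using nn_integral_empirical[of "indicator A" n a] assms by (simp add: nn_integral_indicator)

lemma AE_empirical:
  assumes "\<And>i. i \<in> {1..n} \<Longrightarrow> Q (a i)" and [measurable]: "Measurable.pred borel Q"
  shows "AE y in empirical n a. Q y"
  unfolding empirical_def
  by (subst AE_distr_iff) (auto simp: space_uniform_count_measure assms intro!: AE_I2)

text \<open>Strictness is what yields an actual coupling: the infimum lies below
  \<open>t powr p\<close>, so the cost of some coupling does too.\<close>

lemma wasserstein_less_obtain:
  assumes "wasserstein p Q1 Q2 < ennreal t" "0 < p"
  obtains \<pi> where "\<pi> \<in> couplings Q1 Q2"
    "(\<integral>\<^sup>+y. ennreal (norm (fst y - snd y) powr p) \<partial>\<pi>) \<le> ennreal (t powr p)"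
proof -
  let ?I = "INF \<pi>\<in>couplings Q1 Q2. \<integral>\<^sup>+y. ennreal (norm (fst y - snd y) powr p) \<partial>\<pi>"
  have lt: "epowr ?I (1 / p) < ennreal t" using assms(1) by (simp add: wasserstein_def)
  then have "epowr ?I (1 / p) < \<top>" by (rule order.strict_trans) simp
  then have "?I < \<top>" by (simp only: epowr_less_top_iff)
  then obtain r where r: "0 \<le> r" "?I = ennreal r" by (cases ?I) auto
  then have "r powr (1 / p) < t" using lt by (simp add: epowr_ennreal ennreal_less_iff)
  then have "(r powr (1 / p)) powr p < t powr p" using assms(2) by (intro powr_less_mono2) auto
  then have "r < t powr p" using r assms(2) by (simp add: powr_powr)
  then have "?I < ennreal (t powr p)" using r by (simp add: ennreal_less_iff)
  then show thesis using that by (auto simp: INF_less_iff less_imp_le)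
qed

lemma wasserstein_le:
  assumes "\<pi> \<in> couplings Q1 Q2" "0 < p" "0 \<le> t"
    "(\<integral>\<^sup>+y. ennreal (norm (fst y - snd y) powr p) \<partial>\<pi>) \<le> ennreal (t powr p)"
  shows "wasserstein p Q1 Q2 \<le> ennreal t"
proof -
  have "wasserstein p Q1 Q2 \<le> epowr (ennreal (t powr p)) (1 / p)"
    unfolding wasserstein_def using assms by (intro epowr_mono) (auto intro: INF_lower2)
  also have "\<dots> = ennreal t" using assms by (simp add: epowr_ennreal powr_powr)
  finally show ?thesis .
qed

text \<open>Convexity of \<open>\<lambda>x. x powr p\<close> between the points \<open>1\<close> and
  \<open>s\<close>. At \<open>s = 0\<close> the claim reduces to \<open>l powr p \<le> l\<close>,
  which holds as \<open>l\<close> lies in the unit interval.\<close>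

lemma powr_convex_combination_1:
  fixes l m s p :: real
  assumes "0 \<le> l" "0 \<le> m" "l + m = 1" "0 \<le> s" "1 \<le> p"
  shows "(l + m * s) powr p \<le> l + m * s powr p"
proof (cases "s = 0")
  case True
  have "l powr p \<le> l powr 1" using assms by (intro powr_mono') auto
  with True assms show ?thesis by simp
next
  case False
  from convex_onD[OF powr_convex[OF assms(5)], of m 1 s] assms False
  show ?thesis by (simp add: algebra_simps) (smt (verit) mult.commute)
qed

text \<open>Minkowski's inequality with one constant summand: convexity at the weights
  \<open>K / (K + t)\<close> and \<open>t / (K + t)\<close>.\<close>

lemma nn_integral_powr_const_add:
  fixes f :: "'a \<Rightarrow> real"
  assumes "prob_space P" and [measurable]: "f \<in> borel_measurable P"
    and f0: "\<And>x. 0 \<le> f x" and K: "0 \<le> K" and t: "0 < t" and p: "1 \<le> p"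
    and le: "(\<integral>\<^sup>+x. ennreal (f x powr p) \<partial>P) \<le> ennreal (t powr p)"
  shows "(\<integral>\<^sup>+x. ennreal ((K + f x) powr p) \<partial>P) \<le> ennreal ((K + t) powr p)"
proof -
  interpret prob_space P by fact
  let ?c = "(K + t) powr p" and ?l = "K / (K + t)" and ?m = "t / (K + t)"
  have lm: "0 \<le> ?l" "0 \<le> ?m" "?l + ?m = 1" using K t by (auto simp: add_divide_distrib[symmetric])
  \<comment> \<open>These coefficients make \<open>A + D * s powr p\<close> an upper bound of
    \<open>(K + s) powr p\<close> for all \<open>s \<ge> 0\<close>, attained at
    \<open>s = t\<close>. Integrating it brings in the \<open>p\<close>-th moment linearly.\<close>
  define A where "A = ?c * ?l"
  define D where "D = ?c * ?m / t powr p"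
  have AD: "0 \<le> A" "0 \<le> D" unfolding A_def D_def using K t by auto
  have "A + D * t powr p = ?c * (?l + ?m)" unfolding A_def D_def using t by (simp add: distrib_left)
  then have c: "A + D * t powr p = ?c" by (simp only: lm(3) mult_1_right)
  have pt: "(K + f x) powr p \<le> A + D * f x powr p" for x
  proof -
    have "?l + ?m * (f x / t) = (K + f x) / (K + t)" using t by (simp add: add_divide_distrib)
    then have "(K + f x) powr p = ((K + t) * (?l + ?m * (f x / t))) powr p" using K t by simp
    also have "\<dots> = ?c * (?l + ?m * (f x / t)) powr p"
      by (rule powr_mult)
    also have "\<dots> \<le> ?c * (?l + ?m * (f x / t) powr p)"
      using lm f0[of x] t p by (intro mult_left_mono powr_convex_combination_1) auto
    also have "\<dots> = A + D * f x powr p"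
      using f0[of x] t by (simp add: A_def D_def powr_divide distrib_left)
    finally show ?thesis .
  qed
  have "(\<integral>\<^sup>+x. ennreal ((K + f x) powr p) \<partial>P) \<le>
      (\<integral>\<^sup>+x. ennreal A + ennreal D * ennreal (f x powr p) \<partial>P)"
  proof (rule nn_integral_mono)
    fix x
    have "ennreal A + ennreal D * ennreal (f x powr p) = ennreal (A + D * f x powr p)"
      using AD by (simp add: ennreal_mult')
    then show "ennreal ((K + f x) powr p) \<le> ennreal A + ennreal D * ennreal (f x powr p)"
      using pt by (auto intro: ennreal_leI)
  qed
  also have "\<dots> = ennreal A + ennreal D * (\<integral>\<^sup>+x. ennreal (f x powr p) \<partial>P)"
    by (simp add: nn_integral_add nn_integral_cmult emeasure_space_1)
  also have "\<dots> \<le> ennreal A + ennreal D * ennreal (t powr p)"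
    using le by (intro add_mono mult_left_mono) auto
  also have "\<dots> = ennreal (A + D * t powr p)"
    using AD by (simp add: ennreal_mult')
  finally show ?thesis unfolding c .
qed

lemma couplingsD:
  assumes "\<pi> \<in> couplings Q1 Q2"
  shows "prob_space \<pi>" "sets \<pi> = sets (borel \<Otimes>\<^sub>M borel)"
    "distr \<pi> borel fst = Q1" "distr \<pi> borel snd = Q2"
  using assms by (auto simp: couplings_def)

text \<open>The gluing step of the triangle inequality for \<open>wasserstein\<close>. The atoms \<open>a i\<close> need not be
  distinct, so the mass that \<open>\<pi>\<close> puts over an atom is split evenly among its \<open>N i\<close> indices
  before it is moved to the points \<open>b i\<close>.\<close>

lemma wasserstein_translate_empirical_le:
  fixes a b :: "nat \<Rightarrow> 'b::euclidean_space"
  assumes n: "1 \<le> n" and p: "1 \<le> p" and K: "0 \<le> K" and t: "0 < t"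
    and \<pi>: "\<pi> \<in> couplings (empirical n a) Q"
    and cost: "(\<integral>\<^sup>+y. ennreal (norm (fst y - snd y) powr p) \<partial>\<pi>) \<le> ennreal (t powr p)"
    and b: "\<And>i. i \<in> {1..n} \<Longrightarrow> norm (b i - (a i + h)) \<le> K"
  shows "wasserstein p (distr Q borel (\<lambda>y. y + h)) (empirical n b) \<le> ennreal (K + t)"
proof -
  note \<pi>D = couplingsD[OF \<pi>]
  interpret prob_space \<pi> by fact
  note [measurable_cong] = \<pi>D(2)
  \<comment> \<open>Keeps the simplifier from turning \<open>{1..n}\<close> into
    \<open>{Suc 0..n}\<close>.\<close>
  note One_nat_def [simp del]
  have sQ: "sets Q = sets borel" unfolding \<pi>D(4)[symmetric] by simp
  note [measurable_cong] = sQ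
  define N where "N = (\<lambda>i. card {j \<in> {1..n}. a j = a i})"
  \<comment> \<open>For \<open>fst z\<close> among the atoms, \<open>w i z\<close> is the
    conditional probability of the index \<open>i\<close> given the pair \<open>z\<close>: uniform
    over the indices whose atom is \<open>fst z\<close>.\<close>
  define w where "w = (\<lambda>i (z :: 'b \<times> 'b). ennreal (1 / real (N i)) * indicator {a i} (fst z))"
  have [measurable]: "w i \<in> borel_measurable \<pi>" for i unfolding w_def by measurable
  have N: "0 < N i" if "i \<in> {1..n}" for i
    unfolding N_def by (subst card_gt_0_iff) (use that in auto)
  have sum_w: "(\<Sum>i\<in>{1..n}. w i z) = 1" if z: "fst z \<in> a ` {1..n}" for z
  proof -
    obtain j where j: "j \<in> {1..n}" "fst z = a j" using z by auto
    have "(\<Sum>i\<in>{1..n}. w i z) = (\<Sum>i\<in>{i\<in>{1..n}. a i = a j}. ennreal (1 / real (N j)))"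
      unfolding w_def using j by (intro sum.mono_neutral_cong_right) (auto simp: N_def indicator_def split: if_splits)
    also have "\<dots> = of_nat (N j) * ennreal (1 / real (N j))" by (simp add: N_def)
    also have "\<dots> = ennreal (real (N j) * (1 / real (N j)))"
      by (subst ennreal_mult) (auto simp: ennreal_of_nat_eq_real_of_nat)
    finally show ?thesis using N[OF j(1)] by simp
  qed
  have sum_w_AE: "AE z in \<pi>. (\<Sum>i\<in>{1..n}. w i z) = 1"
  proof -
    have "AE y in distr \<pi> borel fst. y \<in> a ` {1..n}"
      unfolding \<pi>D(3) by (rule AE_empirical) (auto simp: pred_def intro!: borel_closed finite_imp_closed)
    then have "AE z in \<pi>. fst z \<in> a ` {1..n}"
      by (subst (asm) AE_distr_iff) (auto simp: finite_imp_closed borel_closed)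
    then show ?thesis by eventually_elim (rule sum_w)
  qed
  have int_w: "(\<integral>\<^sup>+z. w i z \<partial>\<pi>) = ennreal (1 / real n)" if i: "i \<in> {1..n}" for i
  proof -
    have "(\<integral>\<^sup>+z. w i z \<partial>\<pi>) = ennreal (1 / real (N i)) * (\<integral>\<^sup>+z. indicator {a i} (fst z) \<partial>\<pi>)"
      unfolding w_def by (rule nn_integral_cmult) measurable
    also have "(\<integral>\<^sup>+z. indicator {a i} (fst z) \<partial>\<pi>) = (\<integral>\<^sup>+y. indicator {a i} y \<partial>distr \<pi> borel fst)"
      by (rule nn_integral_distr[symmetric]) measurable
    also have "\<dots> = (\<Sum>j\<in>{1..n}. ennreal (1 / real n) * indicator {a i} (a j))"
      unfolding \<pi>D(3) by (rule nn_integral_empirical) measurable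
    also have "\<dots> = (\<Sum>j\<in>{j\<in>{1..n}. a j = a i}. ennreal (1 / real n))"
      by (intro sum.mono_neutral_cong_right) auto
    also have "\<dots> = ennreal (real (N i) * (1 / real n))"
      by (subst ennreal_mult) (auto simp: ennreal_of_nat_eq_real_of_nat N_def)
    also have "ennreal (1 / real (N i)) * \<dots> = ennreal (1 / real (N i) * (real (N i) * (1 / real n)))"
      by (rule ennreal_mult[symmetric]) auto
    finally show ?thesis using N[OF i] by simp
  qed
  let ?S = "count_space {1..n} \<Otimes>\<^sub>M \<pi>"
  define W where "W = (\<lambda>u. w (fst u) (snd u))"
  define T where "T = (\<lambda>u :: nat \<times> 'b \<times> 'b. (snd (snd u) + h, b (fst u)))"
  have [measurable]: "W \<in> borel_measurable ?S"
    unfolding W_def by (rule measurable_compose_countable'[where I = "{1..n}"]) auto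
  have [measurable]: "(\<lambda>u. b (fst u)) \<in> borel_measurable ?S"
    by (rule measurable_compose[OF measurable_fst]) simp
  have T[measurable]: "T \<in> measurable ?S (borel \<Otimes>\<^sub>M borel)"
    unfolding T_def by measurable
  \<comment> \<open>The glued coupling: draw \<open>z\<close> from \<open>\<pi>\<close>, then an
    index \<open>i\<close> with the weights \<open>w i z\<close>, and record the translated second
    coordinate of \<open>z\<close> together with \<open>b i\<close>.\<close>
  define \<rho> where "\<rho> = distr (density ?S W) (borel \<Otimes>\<^sub>M borel) T"
  have \<rho>: "(\<integral>\<^sup>+v. F v \<partial>\<rho>) = (\<Sum>i\<in>{1..n}. \<integral>\<^sup>+z. w i z * F (snd z + h, b i) \<partial>\<pi>)"
    if [measurable]: "F \<in> borel_measurable (borel \<Otimes>\<^sub>M borel)" for F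
  proof -
    have "(\<integral>\<^sup>+v. F v \<partial>\<rho>) = (\<integral>\<^sup>+u. W u * F (T u) \<partial>?S)"
      unfolding \<rho>_def
      by (simp add: nn_integral_distr nn_integral_density)
    also have "\<dots> = (\<integral>\<^sup>+i. \<integral>\<^sup>+z. W (i, z) * F (T (i, z)) \<partial>\<pi> \<partial>count_space {1..n})"
      by (rule nn_integral_fst[symmetric]) measurable
    also have "\<dots> = (\<Sum>i\<in>{1..n}. \<integral>\<^sup>+z. W (i, z) * F (T (i, z)) \<partial>\<pi>)"
      by (rule nn_integral_count_space_finite) simp
    finally show ?thesis by (simp add: W_def T_def)
  qed
  have em\<rho>: "emeasure (distr \<rho> borel f) A = (\<integral>\<^sup>+v. indicator A (f v) \<partial>\<rho>)"
    if [measurable]: "A \<in> sets borel" "f \<in> borel_measurable (borel \<Otimes>\<^sub>M borel)"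
    for A :: "'b set" and f :: "'b \<times> 'b \<Rightarrow> 'b"
  proof -
    have [measurable]: "f \<in> borel_measurable \<rho>" unfolding \<rho>_def by simp
    have "emeasure (distr \<rho> borel f) A = (\<integral>\<^sup>+y. indicator A y \<partial>distr \<rho> borel f)"
      by (simp add: nn_integral_indicator)
    also have "\<dots> = (\<integral>\<^sup>+v. indicator A (f v) \<partial>\<rho>)" by (rule nn_integral_distr) measurable
    finally show ?thesis .
  qed
  \<comment> \<open>This marginal forgets the index, so the weights sum to one.\<close>
  have 1: "distr \<rho> borel fst = distr Q borel (\<lambda>y. y + h)"
  proof (rule measure_eqI)
    fix A assume "A \<in> sets (distr \<rho> borel fst)"
    then have [measurable]: "A \<in> sets borel" by simp
    have "emeasure (distr \<rho> borel fst) A = (\<Sum>i\<in>{1..n}. \<integral>\<^sup>+z. w i z * indicator A (snd z + h) \<partial>\<pi>)"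
      by (simp add: em\<rho> \<rho>)
    also have "\<dots> = (\<integral>\<^sup>+z. (\<Sum>i\<in>{1..n}. w i z) * indicator A (snd z + h) \<partial>\<pi>)"
      unfolding sum_distrib_right by (rule nn_integral_sum[symmetric]) measurable
    also have "\<dots> = (\<integral>\<^sup>+z. indicator A (snd z + h) \<partial>\<pi>)"
      using sum_w_AE by (intro nn_integral_cong_AE) (auto elim!: eventually_mono)
    also have "\<dots> = (\<integral>\<^sup>+y. indicator A (y + h) \<partial>distr \<pi> borel snd)"
      by (rule nn_integral_distr[symmetric]) measurable
    also have "\<dots> = (\<integral>\<^sup>+y. indicator A y \<partial>distr Q borel (\<lambda>y. y + h))"
      unfolding \<pi>D(4) by (rule nn_integral_distr[symmetric]) measurable
    finally show "emeasure (distr \<rho> borel fst) A = emeasure (distr Q borel (\<lambda>y. y + h)) A"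
      by (simp add: nn_integral_indicator)
  qed simp
  \<comment> \<open>This marginal forgets \<open>z\<close>, which leaves the mass
    \<open>1 / n\<close> for each index by \<open>int_w\<close>.\<close>
  have 2: "distr \<rho> borel snd = empirical n b"
  proof (rule measure_eqI)
    fix A assume "A \<in> sets (distr \<rho> borel snd)"
    then have [measurable]: "A \<in> sets borel" by simp
    have "emeasure (distr \<rho> borel snd) A = (\<Sum>i\<in>{1..n}. \<integral>\<^sup>+z. w i z * indicator A (b i) \<partial>\<pi>)"
      by (simp add: em\<rho> \<rho>)
    also have "\<dots> = (\<Sum>i\<in>{1..n}. ennreal (1 / real n) * indicator A (b i))"
      by (intro sum.cong refl) (simp add: nn_integral_multc int_w)
    finally show "emeasure (distr \<rho> borel snd) A = emeasure (empirical n b) A"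
      by (simp add: emeasure_empirical)
  qed simp
  \<comment> \<open>The total mass of \<open>\<rho>\<close> is read off from a marginal.\<close>
  have "prob_space (distr \<rho> borel snd)" unfolding 2 using n by (rule prob_space_empirical)
  then have "prob_space \<rho>" by (rule prob_space_distrD[rotated]) (simp add: \<rho>_def)
  then have \<rho>C: "\<rho> \<in> couplings (distr Q borel (\<lambda>y. y + h)) (empirical n b)"
    using 1 2 by (simp add: couplings_def \<rho>_def)
  have "(\<integral>\<^sup>+v. ennreal (norm (fst v - snd v) powr p) \<partial>\<rho>) =
      (\<Sum>i\<in>{1..n}. \<integral>\<^sup>+z. w i z * ennreal (norm (snd z + h - b i) powr p) \<partial>\<pi>)"
    by (subst \<rho>) auto
  \<comment> \<open>Where \<open>w i\<close> is nonzero, \<open>fst z\<close> equals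
    \<open>a i\<close>, and the triangle inequality through \<open>a i + h\<close> applies.
    Elsewhere both sides vanish.\<close>
  also have "\<dots> \<le> (\<Sum>i\<in>{1..n}. \<integral>\<^sup>+z. w i z * ennreal ((K + norm (fst z - snd z)) powr p) \<partial>\<pi>)"
  proof (intro sum_mono nn_integral_mono)
    fix i z assume i: "i \<in> {1..n}"
    show "w i z * ennreal (norm (snd z + h - b i) powr p) \<le>
        w i z * ennreal ((K + norm (fst z - snd z)) powr p)"
    proof (cases "fst z = a i")
      case True
      have "snd z + h - b i = - ((b i - (a i + h)) + (fst z - snd z))" using True by simp
      then have "norm (snd z + h - b i) \<le> K + norm (fst z - snd z)"
        using b[OF i] norm_triangle_ineq[of "b i - (a i + h)" "fst z - snd z"]
        by (simp only: norm_minus_cancel)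
      then show ?thesis using p by (intro mult_left_mono ennreal_leI powr_mono2) auto
    qed (simp add: w_def)
  qed
  also have "\<dots> = (\<integral>\<^sup>+z. (\<Sum>i\<in>{1..n}. w i z) * ennreal ((K + norm (fst z - snd z)) powr p) \<partial>\<pi>)"
    by (simp add: sum_distrib_right nn_integral_sum)
  also have "\<dots> = (\<integral>\<^sup>+z. ennreal ((K + norm (fst z - snd z)) powr p) \<partial>\<pi>)"
    using sum_w_AE by (intro nn_integral_cong_AE) (auto elim!: eventually_mono)
  also have "\<dots> \<le> ennreal ((K + t) powr p)"
    using prob_space_axioms K t p cost by (intro nn_integral_powr_const_add) auto
  finally show ?thesis using K t p by (intro wasserstein_le[OF \<rho>C]) auto
qed

subsection \<open>Differences of expectations under a coupling\<close>

text \<open>The cost is symmetric. Couplings obtained from a ball have its member in first place,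
  whereas comparing the centre with the true law requires the centre there.\<close>

lemma couplings_swap:
  assumes \<pi>: "\<pi> \<in> couplings Q P"
  defines "\<pi>' \<equiv> distr \<pi> (borel \<Otimes>\<^sub>M borel) (\<lambda>z. (snd z, fst z))"
  shows "\<pi>' \<in> couplings P Q"
    and "(\<integral>\<^sup>+y. ennreal (norm (fst y - snd y) powr p) \<partial>\<pi>') =
      (\<integral>\<^sup>+y. ennreal (norm (fst y - snd y) powr p) \<partial>\<pi>)"
proof -
  note \<pi>D = couplingsD[OF \<pi>]
  interpret prob_space \<pi> by fact
  note [measurable_cong] = \<pi>D(2)
  have m[measurable]: "(\<lambda>z. (snd z, fst z)) \<in> measurable \<pi> (borel \<Otimes>\<^sub>M borel)" by measurable
  show "\<pi>' \<in> couplings P Q"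
    unfolding couplings_def \<pi>'_def \<pi>D(3,4)[symmetric]
    by (auto simp: distr_distr comp_def prob_space_distr)
  show "(\<integral>\<^sup>+y. ennreal (norm (fst y - snd y) powr p) \<partial>\<pi>') =
      (\<integral>\<^sup>+y. ennreal (norm (fst y - snd y) powr p) \<partial>\<pi>)"
    unfolding \<pi>'_def by (subst nn_integral_distr) (auto simp: norm_minus_commute)
qed

lemma nn_integral_couplings:
  assumes \<pi>: "\<pi> \<in> couplings Q P" and [measurable]: "f \<in> borel_measurable borel"
  shows "(\<integral>\<^sup>+z. f (fst z) \<partial>\<pi>) = (\<integral>\<^sup>+y. f y \<partial>Q)"
    and "(\<integral>\<^sup>+z. f (snd z) \<partial>\<pi>) = (\<integral>\<^sup>+y. f y \<partial>P)"
proof -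
  note \<pi>D = couplingsD[OF \<pi>]
  note [measurable_cong] = \<pi>D(2)
  show "(\<integral>\<^sup>+z. f (fst z) \<partial>\<pi>) = (\<integral>\<^sup>+y. f y \<partial>Q)"
    unfolding \<pi>D(3)[symmetric] by (rule nn_integral_distr[symmetric]) measurable
  show "(\<integral>\<^sup>+z. f (snd z) \<partial>\<pi>) = (\<integral>\<^sup>+y. f y \<partial>P)"
    unfolding \<pi>D(4)[symmetric] by (rule nn_integral_distr[symmetric]) measurable
qed

lemma AE_couplings:
  assumes \<pi>: "\<pi> \<in> couplings Q P" and S: "S \<in> sets borel"
    and Q: "AE y in Q. y \<in> S" and P: "AE y in P. y \<in> S"
  shows "AE z in \<pi>. fst z \<in> S \<and> snd z \<in> S"
proof -
  note \<pi>D = couplingsD[OF \<pi>]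
  note [measurable_cong] = \<pi>D(2)
  have "AE z in \<pi>. fst z \<in> S"
    using Q S unfolding \<pi>D(3)[symmetric] by (subst (asm) AE_distr_iff) auto
  moreover have "AE z in \<pi>. snd z \<in> S"
    using P S unfolding \<pi>D(4)[symmetric] by (subst (asm) AE_distr_iff) auto
  ultimately show ?thesis by eventually_elim simp
qed

section \<open>Moments under a coupling and integrability\<close>

text \<open>For \<open>h \<le> t\<close> the first term suffices. For \<open>h > t\<close> the
  factor \<open>h powr (r - p)\<close> is at most \<open>t powr (r - p)\<close>, the exponent being
  nonpositive.\<close>

lemma powr_le_interpolate:
  fixes h t r p :: real
  assumes "0 \<le> h" "0 < t" "0 \<le> r" "r \<le> p"
  shows "h powr r \<le> t powr r + t powr (r - p) * h powr p"
proof (cases "h \<le> t")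
  case True
  then have "h powr r \<le> t powr r" using assms by (intro powr_mono2) auto
  then show ?thesis by (simp add: add_increasing2)
next
  case False
  then have "h powr r = h powr (r - p) * h powr p" using assms by (simp add: powr_add[symmetric])
  also have "\<dots> \<le> t powr (r - p) * h powr p"
    using False assms by (intro mult_right_mono powr_mono2') auto
  finally show ?thesis by (simp add: add_increasing)
qed

text \<open>Integrates \<open>powr_le_interpolate\<close> at the level \<open>t\<close>, where each
  of the two terms contributes at most \<open>t powr r\<close>. It is applied with
  \<open>r = 1\<close> in the Lipschitz case and \<open>r = 2\<close> in the smooth case.\<close>

lemma nn_integral_powr_mono_exponent:
  fixes f :: "'a \<Rightarrow> real"
  assumes "prob_space P" and [measurable]: "f \<in> borel_measurable P"
    and f0: "\<And>x. 0 \<le> f x" and t: "0 < t" and r: "0 \<le> r" "r \<le> p"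
    and le: "(\<integral>\<^sup>+x. ennreal (f x powr p) \<partial>P) \<le> ennreal (t powr p)"
  shows "(\<integral>\<^sup>+x. ennreal (f x powr r) \<partial>P) \<le> ennreal (2 * t powr r)"
proof -
  interpret prob_space P by fact
  have "(\<integral>\<^sup>+x. ennreal (f x powr r) \<partial>P) \<le>
      (\<integral>\<^sup>+x. ennreal (t powr r) + ennreal (t powr (r - p)) * ennreal (f x powr p) \<partial>P)"
  proof (rule nn_integral_mono)
    fix x
    have eq: "ennreal (t powr r) + ennreal (t powr (r - p)) * ennreal (f x powr p) =
        ennreal (t powr r + t powr (r - p) * f x powr p)"
      by (simp add: ennreal_mult')
    show "ennreal (f x powr r) \<le> ennreal (t powr r) + ennreal (t powr (r - p)) * ennreal (f x powr p)"
      unfolding eq by (intro ennreal_leI powr_le_interpolate f0 t r)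
  qed
  also have "\<dots> = ennreal (t powr r) + ennreal (t powr (r - p)) * (\<integral>\<^sup>+x. ennreal (f x powr p) \<partial>P)"
    by (simp add: nn_integral_add nn_integral_cmult emeasure_space_1)
  also have "\<dots> \<le> ennreal (t powr r) + ennreal (t powr (r - p)) * ennreal (t powr p)"
    using le by (intro add_mono mult_left_mono) auto
  also have "\<dots> = ennreal (t powr r + t powr (r - p) * t powr p)"
    by (simp add: ennreal_mult')
  also have "t powr (r - p) * t powr p = t powr r" by (simp add: powr_add[symmetric])
  finally show ?thesis by simp
qed

lemma powr_add_le:
  fixes x y p :: real
  assumes "0 \<le> x" "0 \<le> y" "0 \<le> p"
  shows "(x + y) powr p \<le> 2 powr p * (x powr p + y powr p)"
proof -
  have "(x + y) powr p \<le> (2 * max x y) powr p" using assms by (intro powr_mono2) auto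
  also have "\<dots> = 2 powr p * (max x y) powr p" by (rule powr_mult)
  also have "\<dots> \<le> 2 powr p * (x powr p + y powr p)" by (intro mult_left_mono) (auto simp: max_def)
  finally show ?thesis .
qed

text \<open>Lets every member of an ambiguity ball inherit a finite \<open>p\<close>-th moment from
  the centre, by the triangle inequality under the coupling.\<close>

lemma moment_couplings:
  fixes Q P :: "'b::euclidean_space measure"
  assumes \<pi>: "\<pi> \<in> couplings Q P" and p: "0 \<le> p"
    and cost: "(\<integral>\<^sup>+y. ennreal (norm (fst y - snd y) powr p) \<partial>\<pi>) \<le> ennreal k"
    and P: "(\<integral>\<^sup>+y. ennreal (norm y powr p) \<partial>P) < \<top>"
  shows "(\<integral>\<^sup>+y. ennreal (norm y powr p) \<partial>Q) < \<top>"
proof -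
  note \<pi>D = couplingsD[OF \<pi>]
  note [measurable_cong] = \<pi>D(2)
  have "(\<integral>\<^sup>+y. ennreal (norm y powr p) \<partial>Q) = (\<integral>\<^sup>+z. ennreal (norm (fst z) powr p) \<partial>\<pi>)"
    by (rule nn_integral_couplings(1)[OF \<pi>, symmetric]) measurable
  also have "\<dots> \<le> (\<integral>\<^sup>+z. ennreal (2 powr p) *
      (ennreal (norm (fst z - snd z) powr p) + ennreal (norm (snd z) powr p)) \<partial>\<pi>)"
  proof (rule nn_integral_mono)
    fix z :: "'b \<times> 'b"
    have "norm (fst z) \<le> norm (fst z - snd z) + norm (snd z)"
      using norm_triangle_ineq[of "fst z - snd z" "snd z"] by simp
    then have "norm (fst z) powr p \<le> (norm (fst z - snd z) + norm (snd z)) powr p"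
      using p by (intro powr_mono2) auto
    also have "\<dots> \<le> 2 powr p * (norm (fst z - snd z) powr p + norm (snd z) powr p)"
      using p by (intro powr_add_le) auto
    finally show "ennreal (norm (fst z) powr p) \<le> ennreal (2 powr p) *
      (ennreal (norm (fst z - snd z) powr p) + ennreal (norm (snd z) powr p))"
      by (simp add: ennreal_mult'[symmetric] ennreal_plus[symmetric] ennreal_leI del: ennreal_plus)
  qed
  also have "\<dots> = ennreal (2 powr p) * ((\<integral>\<^sup>+z. ennreal (norm (fst z - snd z) powr p) \<partial>\<pi>) +
      (\<integral>\<^sup>+z. ennreal (norm (snd z) powr p) \<partial>\<pi>))"
    by (simp add: nn_integral_cmult nn_integral_add)
  also have "(\<integral>\<^sup>+z. ennreal (norm (snd z) powr p) \<partial>\<pi>) = (\<integral>\<^sup>+y. ennreal (norm y powr p) \<partial>P)"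
    by (rule nn_integral_couplings(2)[OF \<pi>]) measurable
  also have "ennreal (2 powr p) * ((\<integral>\<^sup>+z. ennreal (norm (fst z - snd z) powr p) \<partial>\<pi>) + \<dots>) < \<top>"
    using order.strict_trans1[OF cost ennreal_less_top] P by (auto simp: ennreal_mult_less_top)
  finally show ?thesis .
qed

text \<open>The Bochner integral of a non-integrable function is \<open>0\<close> by convention, so
  integrability has to be secured before expectations are compared.\<close>

lemma set_integrable_growth:
  fixes \<phi> :: "'b::euclidean_space \<Rightarrow> real"
  assumes "prob_space Q" and Q: "sets Q = sets borel" and S: "closed S"
    and cont: "continuous_on S \<phi>" and growth: "\<And>y. y \<in> S \<Longrightarrow> \<bar>\<phi> y\<bar> \<le> B * (1 + norm y powr p)"
    and mom: "(\<integral>\<^sup>+y. ennreal (norm y powr p) \<partial>Q) < \<top>"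
  shows "set_integrable Q S \<phi>"
proof -
  interpret prob_space Q by fact
  note [measurable_cong] = Q
  have [measurable]: "(\<lambda>y. indicator S y *\<^sub>R \<phi> y) \<in> borel_measurable borel"
    using S cont by (intro borel_measurable_continuous_on_indicator) auto
  have "integrable Q (\<lambda>y. norm y powr p)"
    using mom by (intro integrableI_nonneg) auto
  then have "integrable Q (\<lambda>y. B * (1 + norm y powr p))" by simp
  then show ?thesis
    unfolding set_integrable_def
  proof (rule Bochner_Integration.integrable_bound)
    show "(\<lambda>y. indicator S y *\<^sub>R \<phi> y) \<in> borel_measurable Q" by measurable
    show "AE y in Q. norm (indicator S y *\<^sub>R \<phi> y) \<le> norm (B * (1 + norm y powr p))"
      using order_trans[OF growth abs_ge_self] by (intro AE_I2) (auto simp: indicator_def)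
  qed
qed

section \<open>Cost differences for Lipschitz and for smooth functions\<close>

text \<open>Both expectations become integrals over the same coupling, so a pointwise bound
  \<open>G\<close> on the increments of \<open>\<phi>\<close> over \<open>S\<close> can be
  integrated.\<close>

lemma expected_diff_le_couplings:
  fixes \<phi> :: "'b::euclidean_space \<Rightarrow> real"
  assumes \<pi>: "\<pi> \<in> couplings Q P" and S: "S \<in> sets borel"
    and Q: "AE y in Q. y \<in> S" "set_integrable Q S \<phi>"
    and P: "AE y in P. y \<in> S" "set_integrable P S \<phi>"
    and G: "\<And>u v. u \<in> S \<Longrightarrow> v \<in> S \<Longrightarrow> ennreal (\<phi> u - \<phi> v) \<le> G (u, v)"
    and k: "(\<integral>\<^sup>+z. G z \<partial>\<pi>) \<le> ennreal k" "0 \<le> k"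
  shows "(LINT y:S|Q. \<phi> y) - (LINT y:S|P. \<phi> y) \<le> k"
proof -
  note \<pi>D = couplingsD[OF \<pi>]
  note [measurable_cong] = \<pi>D(2)
  let ?f = "\<lambda>y. indicator S y *\<^sub>R \<phi> y"
  have Qi: "integrable (distr \<pi> borel fst) ?f" and Pi: "integrable (distr \<pi> borel snd) ?f"
    using Q P unfolding \<pi>D set_integrable_def by auto
  have [measurable]: "?f \<in> borel_measurable borel" using Qi by (auto dest: borel_measurable_integrable)
  have i: "integrable \<pi> (\<lambda>z. ?f (fst z))" "integrable \<pi> (\<lambda>z. ?f (snd z))"
    using Qi Pi by (auto dest!: integrable_distr[rotated])
  have "(LINT y:S|Q. \<phi> y) - (LINT y:S|P. \<phi> y) = (LINT z|\<pi>. ?f (fst z)) - (LINT z|\<pi>. ?f (snd z))"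
    unfolding set_lebesgue_integral_def \<pi>D(3,4)[symmetric]
    by (intro arg_cong2[where f = minus] integral_distr) measurable
  also have "\<dots> = (LINT z|\<pi>. ?f (fst z) - ?f (snd z))" using i by simp
  \<comment> \<open>\<open>ennreal\<close> sends negative values to zero, so the right-hand side is
    the integral of the positive part.\<close>
  also have "\<dots> \<le> enn2real (\<integral>\<^sup>+z. ennreal (?f (fst z) - ?f (snd z)) \<partial>\<pi>)"
    using i by (subst real_lebesgue_integral_def) (auto intro!: Bochner_Integration.integrable_diff)
  also have "(\<integral>\<^sup>+z. ennreal (?f (fst z) - ?f (snd z)) \<partial>\<pi>) \<le> (\<integral>\<^sup>+z. G z \<partial>\<pi>)"
  proof (rule nn_integral_mono_AE)
    show "AE z in \<pi>. ennreal (?f (fst z) - ?f (snd z)) \<le> G z"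
      using AE_couplings[OF \<pi> S Q(1) P(1)]
    proof eventually_elim
      case (elim z)
      then show ?case using G[of "fst z" "snd z"] by simp
    qed
  qed
  then have "enn2real (\<integral>\<^sup>+z. ennreal (?f (fst z) - ?f (snd z)) \<partial>\<pi>) \<le> k"
    using k by (intro enn2real_leI) auto
  finally show ?thesis .
qed

text \<open>The increments are bounded by \<open>L\<close> times the displacement, whose first
  moment is at most \<open>2 * t\<close>; this is the origin of the factor \<open>2\<close>.\<close>

lemma expected_diff_lipschitz:
  fixes \<phi> :: "'b::euclidean_space \<Rightarrow> real"
  assumes \<pi>: "\<pi> \<in> couplings Q P" and S: "S \<in> sets borel" and p: "1 \<le> p" and t: "0 < t"
    and cost: "(\<integral>\<^sup>+y. ennreal (norm (fst y - snd y) powr p) \<partial>\<pi>) \<le> ennreal (t powr p)"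
    and Q: "AE y in Q. y \<in> S" "set_integrable Q S \<phi>"
    and P: "AE y in P. y \<in> S" "set_integrable P S \<phi>"
    and L: "L-lipschitz_on S \<phi>"
  shows "(LINT y:S|Q. \<phi> y) - (LINT y:S|P. \<phi> y) \<le> 2 * L * t"
proof (rule expected_diff_le_couplings[OF \<pi> S Q P])
  note \<pi>D = couplingsD[OF \<pi>]
  note [measurable_cong] = \<pi>D(2)
  have L0: "0 \<le> L" using L by (rule lipschitz_on_nonneg)
  let ?G = "\<lambda>z :: 'b \<times> 'b. ennreal L * ennreal (norm (fst z - snd z) powr 1)"
  show "ennreal (\<phi> u - \<phi> v) \<le> ?G (u, v)" if "u \<in> S" "v \<in> S" for u v
    using lipschitz_onD[OF L that] L0
    by (auto simp: ennreal_mult[symmetric] dist_norm intro!: ennreal_leI)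
  have "(\<integral>\<^sup>+z. ?G z \<partial>\<pi>) = ennreal L * (\<integral>\<^sup>+z. ennreal (norm (fst z - snd z) powr 1) \<partial>\<pi>)"
    by (rule nn_integral_cmult) measurable
  also have "\<dots> \<le> ennreal L * ennreal (2 * t powr 1)"
    using \<pi>D(1) t p cost by (intro mult_left_mono nn_integral_powr_mono_exponent) auto
  also have "\<dots> = ennreal (2 * L * t)" using L0 t by (simp add: ennreal_mult'[symmetric] mult_ac)
  finally show "(\<integral>\<^sup>+z. ?G z \<partial>\<pi>) \<le> ennreal (2 * L * t)" .
  show "0 \<le> 2 * L * t" using L0 t by simp
qed

text \<open>Mean value theorem on the segment from \<open>v\<close> to \<open>u\<close>, which stays
  in \<open>S\<close> by convexity; the gradient at the intermediate point is then compared with the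
  gradient at \<open>v\<close>.\<close>

lemma smooth_diff_le:
  fixes \<phi> :: "'b::euclidean_space \<Rightarrow> real"
  assumes S: "convex S" and uv: "u \<in> S" "v \<in> S"
    and der: "\<And>y. y \<in> S \<Longrightarrow> (\<phi> has_derivative (\<lambda>h. gr y \<bullet> h)) (at y within S)"
    and lip: "\<And>y y'. y \<in> S \<Longrightarrow> y' \<in> S \<Longrightarrow> norm (gr y' - gr y) \<le> L * norm (y' - y)"
  shows "\<phi> u - \<phi> v \<le> norm (gr v) * norm (u - v) + \<bar>L\<bar> * (norm (u - v))\<^sup>2"
proof -
  define \<gamma> where "\<gamma> = (\<lambda>s::real. v + s *\<^sub>R (u - v))"
  have \<gamma>: "\<gamma> s \<in> S" if "s \<in> {0..1}" for s
  proof -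
    have "\<gamma> s = (1 - s) *\<^sub>R v + s *\<^sub>R u" by (simp add: \<gamma>_def algebra_simps)
    then show ?thesis using S uv that by (auto intro!: convexD)
  qed
  have "((\<lambda>s. \<phi> (\<gamma> s)) has_derivative (\<lambda>h. gr (\<gamma> s) \<bullet> (h *\<^sub>R (u - v)))) (at s within {0..1})"
    if "s \<in> {0..1}" for s
  proof (rule has_derivative_in_compose2[of S \<phi> "\<lambda>y h. gr y \<bullet> h"])
    show "(\<gamma> has_derivative (\<lambda>h. h *\<^sub>R (u - v))) (at s within {0..1})"
      unfolding \<gamma>_def by (auto intro!: derivative_eq_intros)
  qed (use that \<gamma> der in auto)
  then obtain s where s: "s \<in> {0<..<1}" "\<phi> (\<gamma> 1) - \<phi> (\<gamma> 0) = gr (\<gamma> s) \<bullet> ((1 - 0) *\<^sub>R (u - v))"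
    using mvt_simple[of 0 1 "\<lambda>s. \<phi> (\<gamma> s)" "\<lambda>s h. gr (\<gamma> s) \<bullet> (h *\<^sub>R (u - v))"] by force
  have "norm (gr (\<gamma> s) - gr v) \<le> L * norm (\<gamma> s - v)" using s uv \<gamma> by (intro lip) auto
  \<comment> \<open>The sign of \<open>L\<close> is not prescribed, hence the absolute
    value.\<close>
  also have "\<dots> \<le> \<bar>L\<bar> * norm (u - v)"
    using s by (intro mult_mono) (auto simp: \<gamma>_def mult_left_le_one_le)
  finally have 1: "norm (gr (\<gamma> s) - gr v) \<le> \<bar>L\<bar> * norm (u - v)" .
  have "\<phi> u - \<phi> v = gr v \<bullet> (u - v) + (gr (\<gamma> s) - gr v) \<bullet> (u - v)"
    using s by (simp add: \<gamma>_def inner_diff_left)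
  also have "\<dots> \<le> norm (gr v) * norm (u - v) + norm (gr (\<gamma> s) - gr v) * norm (u - v)"
    by (intro add_mono norm_cauchy_schwarz)
  also have "\<dots> \<le> norm (gr v) * norm (u - v) + (\<bar>L\<bar> * norm (u - v)) * norm (u - v)"
    using 1 by (intro add_left_mono mult_right_mono) auto
  finally show ?thesis by (simp add: power2_eq_square mult.assoc)
qed

lemma ennreal_power2_le_imp_le:
  assumes "x\<^sup>2 \<le> ennreal (k\<^sup>2)" "0 \<le> k" shows "x \<le> ennreal k"
proof (cases x)
  case (real r)
  then show ?thesis using assms by (auto simp: ennreal_power intro!: ennreal_leI power2_le_imp_le)
qed (use assms in \<open>auto simp: top_unique power2_eq_square ennreal_mult_top\<close>)

text \<open>Integrates \<open>smooth_diff_le\<close>. The linear term is handled by Cauchy-Schwarz,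
  with the gradient moment under \<open>P\<close> and the second moment of the displacement, which
  is controlled because \<open>p \<ge> 2\<close>. The gradient is cut off outside \<open>S\<close>,
  where nothing is known about it.\<close>

lemma expected_diff_smooth:
  fixes \<phi> :: "'b::euclidean_space \<Rightarrow> real"
  assumes \<pi>: "\<pi> \<in> couplings Q P" and S: "closed S" "convex S" and p: "2 \<le> p" and t: "0 < t"
    and cost: "(\<integral>\<^sup>+y. ennreal (norm (fst y - snd y) powr p) \<partial>\<pi>) \<le> ennreal (t powr p)"
    and Q: "AE y in Q. y \<in> S" "set_integrable Q S \<phi>"
    and P: "AE y in P. y \<in> S" "set_integrable P S \<phi>"
    and der: "\<And>y. y \<in> S \<Longrightarrow> (\<phi> has_derivative (\<lambda>h. gr y \<bullet> h)) (at y within S)"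
    and lip: "\<And>y y'. y \<in> S \<Longrightarrow> y' \<in> S \<Longrightarrow> norm (gr y' - gr y) \<le> L * norm (y' - y)"
    and m[measurable]: "(\<lambda>y. indicator S y *\<^sub>R gr y) \<in> borel_measurable borel"
    and k: "0 \<le> k" "(\<integral>\<^sup>+y. ennreal ((norm (indicator S y *\<^sub>R gr y))\<^sup>2) \<partial>P) \<le> ennreal (k\<^sup>2)"
  shows "(LINT y:S|Q. \<phi> y) - (LINT y:S|P. \<phi> y) \<le> 2 * k * t + 2 * \<bar>L\<bar> * t\<^sup>2"
proof (rule expected_diff_le_couplings[OF \<pi> _ Q P])
  note \<pi>D = couplingsD[OF \<pi>]
  note [measurable_cong] = \<pi>D(2)
  show "S \<in> sets borel" using S by simp
  let ?n = "\<lambda>z :: 'b \<times> 'b. norm (fst z - snd z)"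
  let ?g = "\<lambda>z :: 'b \<times> 'b. norm (indicator S (snd z) *\<^sub>R gr (snd z))"
  let ?G = "\<lambda>z. ennreal (?g z) * ennreal (?n z) + ennreal \<bar>L\<bar> * ennreal ((?n z)\<^sup>2)"
  show "ennreal (\<phi> u - \<phi> v) \<le> ?G (u, v)" if "u \<in> S" "v \<in> S" for u v
    using smooth_diff_le[OF S(2) that der lip] that
    by (auto simp: ennreal_mult[symmetric] ennreal_plus[symmetric] simp del: ennreal_plus intro!: ennreal_leI)
  have [measurable]: "?g \<in> borel_measurable \<pi>" using m by measurable
  have n2: "(\<integral>\<^sup>+z. ennreal ((?n z)\<^sup>2) \<partial>\<pi>) \<le> ennreal (2 * t\<^sup>2)"
    using nn_integral_powr_mono_exponent[OF \<pi>D(1), of ?n t 2 p] t p cost by simp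
  have g2: "(\<integral>\<^sup>+z. ennreal ((?g z)\<^sup>2) \<partial>\<pi>) \<le> ennreal (k\<^sup>2)"
    by (subst nn_integral_couplings(2)[OF \<pi>]) (measurable, fact k)
  have "(\<integral>\<^sup>+z. ennreal (?g z) * ennreal (?n z) \<partial>\<pi>)\<^sup>2 \<le>
      (\<integral>\<^sup>+z. (ennreal (?g z))\<^sup>2 \<partial>\<pi>) * (\<integral>\<^sup>+z. (ennreal (?n z))\<^sup>2 \<partial>\<pi>)"
    by (rule Cauchy_Schwarz_nn_integral) measurable
  also have "\<dots> \<le> ennreal (k\<^sup>2) * ennreal (2 * t\<^sup>2)"
    using g2 n2 by (intro mult_mono) (auto simp: ennreal_power)
  also have "\<dots> = ennreal (2 * (k\<^sup>2 * t\<^sup>2))" by (simp add: ennreal_mult'[symmetric] mult_ac)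
  \<comment> \<open>The constant \<open>sqrt 2\<close> is rounded up to \<open>2\<close>.\<close>
  also have "\<dots> \<le> ennreal ((2 * k * t)\<^sup>2)"
    by (intro ennreal_leI) (simp add: power_mult_distrib)
  finally have "(\<integral>\<^sup>+z. ennreal (?g z) * ennreal (?n z) \<partial>\<pi>) \<le> ennreal (2 * k * t)"
    by (rule ennreal_power2_le_imp_le) (use k t in simp)
  moreover have "ennreal \<bar>L\<bar> * (\<integral>\<^sup>+z. ennreal ((?n z)\<^sup>2) \<partial>\<pi>) \<le> ennreal (2 * \<bar>L\<bar> * t\<^sup>2)"
  proof -
    have "ennreal \<bar>L\<bar> * (\<integral>\<^sup>+z. ennreal ((?n z)\<^sup>2) \<partial>\<pi>) \<le> ennreal \<bar>L\<bar> * ennreal (2 * t\<^sup>2)"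
      using n2 by (rule mult_left_mono) simp
    also have "\<dots> = ennreal (\<bar>L\<bar> * (2 * t\<^sup>2))" by (rule ennreal_mult'[symmetric]) simp
    finally show ?thesis by (simp add: mult_ac)
  qed
  moreover have "(\<integral>\<^sup>+z. ?G z \<partial>\<pi>) = (\<integral>\<^sup>+z. ennreal (?g z) * ennreal (?n z) \<partial>\<pi>) +
      (\<integral>\<^sup>+z. ennreal \<bar>L\<bar> * ennreal ((?n z)\<^sup>2) \<partial>\<pi>)"
    by (rule nn_integral_add) measurable
  moreover have "(\<integral>\<^sup>+z. ennreal \<bar>L\<bar> * ennreal ((?n z)\<^sup>2) \<partial>\<pi>) =
      ennreal \<bar>L\<bar> * (\<integral>\<^sup>+z. ennreal ((?n z)\<^sup>2) \<partial>\<pi>)"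
    by (rule nn_integral_cmult) measurable
  ultimately have "(\<integral>\<^sup>+z. ?G z \<partial>\<pi>) \<le> ennreal (2 * k * t) + ennreal (2 * \<bar>L\<bar> * t\<^sup>2)"
    by (simp only: add_mono)
  also have "\<dots> = ennreal (2 * k * t + 2 * \<bar>L\<bar> * t\<^sup>2)" using k t by simp
  finally show "(\<integral>\<^sup>+z. ?G z \<partial>\<pi>) \<le> ennreal (2 * k * t + 2 * \<bar>L\<bar> * t\<^sup>2)" .
  show "0 \<le> 2 * k * t + 2 * \<bar>L\<bar> * t\<^sup>2" using k t by simp
qed

text \<open>Case (B) bounds the gradient under the true law, but comparing a member of the ball with
  its centre by \<open>expected_diff_smooth\<close> calls for a bound under the centre. The
  Lipschitz property of the gradient transports the bound along a coupling.\<close>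

lemma gradient_moment_couplings:
  fixes gr :: "'b::euclidean_space \<Rightarrow> 'b"
  assumes \<pi>: "\<pi> \<in> couplings R P" and S: "S \<in> sets borel" and p: "2 \<le> p" and t: "0 < t"
    and cost: "(\<integral>\<^sup>+y. ennreal (norm (fst y - snd y) powr p) \<partial>\<pi>) \<le> ennreal (t powr p)"
    and R: "AE y in R. y \<in> S" and P: "AE y in P. y \<in> S"
    and lip: "\<And>y y'. y \<in> S \<Longrightarrow> y' \<in> S \<Longrightarrow> norm (gr y' - gr y) \<le> L * norm (y' - y)"
    and m[measurable]: "(\<lambda>y. indicator S y *\<^sub>R gr y) \<in> borel_measurable borel"
    and k: "0 \<le> k" "(\<integral>\<^sup>+y. ennreal ((norm (indicator S y *\<^sub>R gr y))\<^sup>2) \<partial>P) \<le> ennreal (k\<^sup>2)"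
  shows "(\<integral>\<^sup>+y. ennreal ((norm (indicator S y *\<^sub>R gr y))\<^sup>2) \<partial>R) \<le> ennreal ((2 * k + 2 * \<bar>L\<bar> * t)\<^sup>2)"
proof -
  note \<pi>D = couplingsD[OF \<pi>]
  note [measurable_cong] = \<pi>D(2)
  let ?n = "\<lambda>z :: 'b \<times> 'b. norm (fst z - snd z)"
  define h where "h = (\<lambda>y. (norm (indicator S y *\<^sub>R gr y))\<^sup>2)"
  have h_S: "h y = (norm (gr y))\<^sup>2" if "y \<in> S" for y using that by (simp add: h_def)
  have h0: "0 \<le> h y" for y by (simp add: h_def)
  have [measurable]: "h \<in> borel_measurable borel" unfolding h_def using m by measurable
  note k = k[folded h_def[THEN fun_cong]]
  have n2: "(\<integral>\<^sup>+z. ennreal ((?n z)\<^sup>2) \<partial>\<pi>) \<le> ennreal (2 * t\<^sup>2)"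
    using nn_integral_powr_mono_exponent[OF \<pi>D(1), of ?n t 2 p] t p cost by simp
  have "(\<integral>\<^sup>+y. ennreal (h y) \<partial>R) = (\<integral>\<^sup>+z. ennreal (h (fst z)) \<partial>\<pi>)"
    by (rule nn_integral_couplings(1)[OF \<pi>, symmetric]) measurable
  also have "\<dots> \<le> (\<integral>\<^sup>+z. ennreal 2 * ennreal (h (snd z)) + ennreal (2 * L\<^sup>2) * ennreal ((?n z)\<^sup>2) \<partial>\<pi>)"
  proof (rule nn_integral_mono_AE)
    show "AE z in \<pi>. ennreal (h (fst z)) \<le>
        ennreal 2 * ennreal (h (snd z)) + ennreal (2 * L\<^sup>2) * ennreal ((?n z)\<^sup>2)"
      using AE_couplings[OF \<pi> S R P]
    proof eventually_elim
      case (elim z)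
      let ?a = "norm (gr (snd z))" and ?b = "\<bar>L\<bar> * ?n z"
      have "norm (gr (fst z)) \<le> ?a + norm (gr (fst z) - gr (snd z))"
        using norm_triangle_ineq[of "gr (snd z)" "gr (fst z) - gr (snd z)"] by simp
      also have "norm (gr (fst z) - gr (snd z)) \<le> L * ?n z" using elim by (intro lip) auto
      also have "\<dots> \<le> ?b" by (intro mult_right_mono) auto
      finally have "(norm (gr (fst z)))\<^sup>2 \<le> (?a + ?b)\<^sup>2" by (intro power_mono) auto
      also have "\<dots> \<le> 2 * ?a\<^sup>2 + 2 * ?b\<^sup>2"
        using sum_squares_bound[of ?a ?b] by (simp add: power2_sum)
      also have "2 * ?b\<^sup>2 = 2 * L\<^sup>2 * (?n z)\<^sup>2" by (simp add: power_mult_distrib)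
      finally have "h (fst z) \<le> 2 * h (snd z) + 2 * L\<^sup>2 * (?n z)\<^sup>2" using elim by (simp add: h_S)
      then have "ennreal (h (fst z)) \<le> ennreal (2 * h (snd z) + 2 * L\<^sup>2 * (?n z)\<^sup>2)"
        by (rule ennreal_leI)
      also have "\<dots> = ennreal 2 * ennreal (h (snd z)) + ennreal (2 * L\<^sup>2) * ennreal ((?n z)\<^sup>2)"
        by (subst ennreal_plus) (auto simp only: ennreal_mult' h0 zero_le_power2 mult_nonneg_nonneg zero_le_numeral)
      finally show ?case .
    qed
  qed
  also have "\<dots> = ennreal 2 * (\<integral>\<^sup>+z. ennreal (h (snd z)) \<partial>\<pi>) + ennreal (2 * L\<^sup>2) * (\<integral>\<^sup>+z. ennreal ((?n z)\<^sup>2) \<partial>\<pi>)"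
    by (simp add: nn_integral_add nn_integral_cmult del: ennreal_numeral)
  also have "(\<integral>\<^sup>+z. ennreal (h (snd z)) \<partial>\<pi>) = (\<integral>\<^sup>+y. ennreal (h y) \<partial>P)"
    by (rule nn_integral_couplings(2)[OF \<pi>]) measurable
  also have "ennreal 2 * \<dots> + ennreal (2 * L\<^sup>2) * (\<integral>\<^sup>+z. ennreal ((?n z)\<^sup>2) \<partial>\<pi>) \<le>
      ennreal 2 * ennreal (k\<^sup>2) + ennreal (2 * L\<^sup>2) * ennreal (2 * t\<^sup>2)"
    using k n2 by (intro add_mono mult_left_mono) auto
  also have "\<dots> = ennreal (2 * k\<^sup>2 + 2 * L\<^sup>2 * (2 * t\<^sup>2))"
    by (simp add: ennreal_mult'[symmetric] ennreal_plus[symmetric] del: ennreal_plus ennreal_numeral)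
  \<comment> \<open>Enlarged to a perfect square, the form in which
    \<open>expected_diff_smooth\<close> takes the moment bound.\<close>
  also have "\<dots> \<le> ennreal ((2 * k + 2 * \<bar>L\<bar> * t)\<^sup>2)"
  proof (rule ennreal_leI)
    have "0 \<le> k * \<bar>L\<bar> * t" using k t by simp
    then show "2 * k\<^sup>2 + 2 * L\<^sup>2 * (2 * t\<^sup>2) \<le> (2 * k + 2 * \<bar>L\<bar> * t)\<^sup>2"
      by (simp add: power2_sum power_mult_distrib algebra_simps) 
  qed
  finally show ?thesis by (simp only: h_def)
qed

subsection \<open>Ambiguity balls\<close>

text \<open>Doubling the positive radius makes the inequality strict, as
  \<open>wasserstein_less_obtain\<close> requires.\<close>

lemma wasserstein_ballE:
  assumes "Q \<in> wasserstein_ball p S R \<zeta>" "0 < \<zeta>" "0 < p"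
  obtains \<pi> where "\<pi> \<in> couplings Q R"
    "(\<integral>\<^sup>+y. ennreal (norm (fst y - snd y) powr p) \<partial>\<pi>) \<le> ennreal ((2 * \<zeta>) powr p)"
    "prob_space Q" "sets Q = sets borel" "AE y in Q. y \<in> S"
proof -
  have "wasserstein p Q R \<le> ennreal \<zeta>" and Q: "Q \<in> prob_measures_on S"
    using assms by (auto simp: wasserstein_ball_def)
  note this(1)
  also have "ennreal \<zeta> < ennreal (2 * \<zeta>)" using assms by (simp add: ennreal_less_iff)
  finally show thesis
    using Q assms(3) that by (elim wasserstein_less_obtain) (auto simp: prob_measures_on_def)
qed

text \<open>The comparison passes through the centre \<open>R\<close>. Each leg has a coupling of
  cost at most \<open>(2 * \<zeta>) powr p\<close> and contributes
  \<open>4 * L * \<zeta>\<close>.\<close>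

lemma wasserstein_ball_diff_lipschitz:
  fixes \<phi> :: "'b::euclidean_space \<Rightarrow> real"
  assumes S: "closed S" and p: "1 \<le> p" and \<zeta>: "0 < \<zeta>"
    and R: "R \<in> prob_measures_on S" "(\<integral>\<^sup>+y. ennreal (norm y powr p) \<partial>R) < \<top>"
    and Q: "Q \<in> wasserstein_ball p S R \<zeta>" and P: "P \<in> wasserstein_ball p S R \<zeta>"
    and cont: "continuous_on S \<phi>" and growth: "\<And>y. y \<in> S \<Longrightarrow> \<bar>\<phi> y\<bar> \<le> B * (1 + norm y powr p)"
    and L: "L-lipschitz_on S \<phi>"
  shows "(LINT y:S|Q. \<phi> y) - (LINT y:S|P. \<phi> y) \<le> 8 * L * \<zeta>"
proof -
  have p0: "0 < p" "0 \<le> p" using p by auto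
  have t: "0 < 2 * \<zeta>" using \<zeta> by simp
  have RD: "prob_space R" "sets R = sets borel" "AE y in R. y \<in> S"
    using R by (auto simp: prob_measures_on_def)
  obtain \<pi> where \<pi>: "\<pi> \<in> couplings Q R"
      "(\<integral>\<^sup>+y. ennreal (norm (fst y - snd y) powr p) \<partial>\<pi>) \<le> ennreal ((2 * \<zeta>) powr p)"
      "prob_space Q" "sets Q = sets borel" "AE y in Q. y \<in> S"
    using Q \<zeta> p0(1) by (rule wasserstein_ballE)
  obtain \<tau> where \<tau>: "\<tau> \<in> couplings P R"
      "(\<integral>\<^sup>+y. ennreal (norm (fst y - snd y) powr p) \<partial>\<tau>) \<le> ennreal ((2 * \<zeta>) powr p)"
      "prob_space P" "sets P = sets borel" "AE y in P. y \<in> S"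
    using P \<zeta> p0(1) by (rule wasserstein_ballE)
  note int = set_integrable_growth[OF _ _ S cont growth]
  have iR: "set_integrable R S \<phi>" using int[OF RD(1,2)] R(2) by simp
  have iQ: "set_integrable Q S \<phi>"
    using int[OF \<pi>(3,4)] moment_couplings[OF \<pi>(1) p0(2) \<pi>(2) R(2)] by simp
  have iP: "set_integrable P S \<phi>"
    using int[OF \<tau>(3,4)] moment_couplings[OF \<tau>(1) p0(2) \<tau>(2) R(2)] by simp
  note \<tau>' = couplings_swap[OF \<tau>(1)]
  have "(LINT y:S|Q. \<phi> y) - (LINT y:S|R. \<phi> y) \<le> 2 * L * (2 * \<zeta>)"
    by (rule expected_diff_lipschitz[OF \<pi>(1) borel_closed[OF S] p t \<pi>(2,5) iQ RD(3) iR L])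
  moreover have "(LINT y:S|R. \<phi> y) - (LINT y:S|P. \<phi> y) \<le> 2 * L * (2 * \<zeta>)"
    by (rule expected_diff_lipschitz[OF \<tau>'(1) borel_closed[OF S] p t _ RD(3) iR \<tau>(5) iP L])
      (simp only: \<tau>'(2) \<tau>(2))
  ultimately show ?thesis by simp
qed

text \<open>Again two legs through \<open>R\<close>. The leg from \<open>R\<close> to
  \<open>P\<close> uses the gradient moment under \<open>P\<close> directly; the leg from
  \<open>Q\<close> to \<open>R\<close> uses its transported version.\<close>

lemma wasserstein_ball_diff_smooth:
  fixes \<phi> :: "'b::euclidean_space \<Rightarrow> real"
  assumes S: "closed S" "convex S" and p: "2 \<le> p" and \<zeta>: "0 < \<zeta>" "\<zeta> \<le> 1 / 2"
    and R: "R \<in> prob_measures_on S" "(\<integral>\<^sup>+y. ennreal (norm y powr p) \<partial>R) < \<top>"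
    and Q: "Q \<in> wasserstein_ball p S R \<zeta>" and P: "P \<in> wasserstein_ball p S R \<zeta>"
    and cont: "continuous_on S \<phi>" and growth: "\<And>y. y \<in> S \<Longrightarrow> \<bar>\<phi> y\<bar> \<le> B * (1 + norm y powr p)"
    and der: "\<And>y. y \<in> S \<Longrightarrow> (\<phi> has_derivative (\<lambda>h. gr y \<bullet> h)) (at y within S)"
    and lip: "\<And>y y'. y \<in> S \<Longrightarrow> y' \<in> S \<Longrightarrow> norm (gr y' - gr y) \<le> L * norm (y' - y)"
    and k: "0 \<le> k" "(\<integral>\<^sup>+y\<in>S. ennreal ((norm (gr y))\<^sup>2) \<partial>P) \<le> ennreal (k\<^sup>2)"
  shows "(LINT y:S|Q. \<phi> y) - (LINT y:S|P. \<phi> y) \<le> 16 * (k + \<bar>L\<bar>) * \<zeta>"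
proof -
  have p0: "0 < p" "0 \<le> p" using p by auto
  define t where "t = 2 * \<zeta>"
  have t: "0 < t" "t \<le> 1" using \<zeta> by (auto simp: t_def)
  have RD: "prob_space R" "sets R = sets borel" "AE y in R. y \<in> S"
    using R by (auto simp: prob_measures_on_def)
  obtain \<pi> where \<pi>: "\<pi> \<in> couplings Q R"
      "(\<integral>\<^sup>+y. ennreal (norm (fst y - snd y) powr p) \<partial>\<pi>) \<le> ennreal (t powr p)"
      "prob_space Q" "sets Q = sets borel" "AE y in Q. y \<in> S"
    unfolding t_def using Q \<zeta>(1) p0(1) by (rule wasserstein_ballE)
  obtain \<tau> where \<tau>: "\<tau> \<in> couplings P R"
      "(\<integral>\<^sup>+y. ennreal (norm (fst y - snd y) powr p) \<partial>\<tau>) \<le> ennreal (t powr p)"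
      "prob_space P" "sets P = sets borel" "AE y in P. y \<in> S"
    unfolding t_def using P \<zeta>(1) p0(1) by (rule wasserstein_ballE)
  note int = set_integrable_growth[OF _ _ S(1) cont growth]
  have iR: "set_integrable R S \<phi>" using int[OF RD(1,2)] R(2) by simp
  have iQ: "set_integrable Q S \<phi>"
    using int[OF \<pi>(3,4)] moment_couplings[OF \<pi>(1) p0(2) \<pi>(2) R(2)] by simp
  have iP: "set_integrable P S \<phi>"
    using int[OF \<tau>(3,4)] moment_couplings[OF \<tau>(1) p0(2) \<tau>(2) R(2)] by simp
  note \<tau>' = couplings_swap[OF \<tau>(1)]
  have cost': "(\<integral>\<^sup>+y. ennreal (norm (fst y - snd y) powr p) \<partial>distr \<tau> (borel \<Otimes>\<^sub>M borel) (\<lambda>z. (snd z, fst z)))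
      \<le> ennreal (t powr p)"
    by (simp only: \<tau>'(2) \<tau>(2))
  \<comment> \<open>A Lipschitz gradient is continuous on the closed set \<open>S\<close>, so its
    extension by zero is Borel measurable.\<close>
  have "\<bar>L\<bar>-lipschitz_on S gr"
  proof (rule lipschitz_onI)
    fix y y' assume "y \<in> S" "y' \<in> S"
    then have "dist (gr y) (gr y') \<le> L * dist y y'" using lip by (simp add: dist_norm)
    also have "\<dots> \<le> \<bar>L\<bar> * dist y y'" by (intro mult_right_mono) auto
    finally show "dist (gr y) (gr y') \<le> \<bar>L\<bar> * dist y y'" .
  qed simp
  then have m: "(\<lambda>y. indicator S y *\<^sub>R gr y) \<in> borel_measurable borel"
    using S by (intro borel_measurable_continuous_on_indicator lipschitz_on_continuous_on) auto
  have "(\<integral>\<^sup>+y. ennreal ((norm (indicator S y *\<^sub>R gr y))\<^sup>2) \<partial>P) = (\<integral>\<^sup>+y\<in>S. ennreal ((norm (gr y))\<^sup>2) \<partial>P)"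
    by (intro nn_integral_cong) (auto simp: indicator_def)
  then have k': "(\<integral>\<^sup>+y. ennreal ((norm (indicator S y *\<^sub>R gr y))\<^sup>2) \<partial>P) \<le> ennreal (k\<^sup>2)"
    using k(2) by simp
  define k2 where "k2 = 2 * k + 2 * \<bar>L\<bar> * t"
  have k2: "0 \<le> k2" using k(1) t by (simp add: k2_def)
  have kR: "(\<integral>\<^sup>+y. ennreal ((norm (indicator S y *\<^sub>R gr y))\<^sup>2) \<partial>R) \<le> ennreal (k2\<^sup>2)"
    unfolding k2_def
    by (rule gradient_moment_couplings[OF \<tau>'(1) borel_closed[OF S(1)] p t(1) cost' RD(3) \<tau>(5) lip m k(1) k'])
  have 1: "(LINT y:S|Q. \<phi> y) - (LINT y:S|R. \<phi> y) \<le> 2 * k2 * t + 2 * \<bar>L\<bar> * t\<^sup>2"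
    by (rule expected_diff_smooth[OF \<pi>(1) S p t(1) \<pi>(2,5) iQ RD(3) iR der lip m k2 kR])
  have 2: "(LINT y:S|R. \<phi> y) - (LINT y:S|P. \<phi> y) \<le> 2 * k * t + 2 * \<bar>L\<bar> * t\<^sup>2"
    by (rule expected_diff_smooth[OF \<tau>'(1) S p t(1) cost' RD(3) iR \<tau>(5) iP der lip m k(1) k'])
  \<comment> \<open>Inserting \<open>k2\<close>, the first leg gives
    \<open>4 * k * t + 6 * \<bar>L\<bar> * t\<^sup>2\<close> and the second
    \<open>2 * k * t + 2 * \<bar>L\<bar> * t\<^sup>2\<close>. Afterwards \<open>t \<le> 1\<close>
    makes the squares linear.\<close>
  have "(LINT y:S|Q. \<phi> y) - (LINT y:S|P. \<phi> y) \<le> 6 * (k * t) + 8 * (\<bar>L\<bar> * t\<^sup>2)"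
    using add_mono[OF 1 2] by (simp add: k2_def algebra_simps power2_eq_square)
  also have "\<bar>L\<bar> * t\<^sup>2 \<le> \<bar>L\<bar> * t"
    using t by (intro mult_left_mono) (auto simp: power2_eq_square mult_left_le)
  also have "6 * (k * t) + 8 * (\<bar>L\<bar> * t) \<le> 8 * (k * t) + 8 * (\<bar>L\<bar> * t)"
    using k(1) t by simp
  finally show ?thesis by (simp add: t_def algebra_simps)
qed

text \<open>The restriction \<open>\<zeta> \<le> 1 / 2\<close> absorbs the quadratic term of case (B).\<close>

lemma ex_cost_modulus:
  fixes c :: "'z \<Rightarrow> 'y::euclidean_space \<Rightarrow> real" and P\<^sub>X :: "'x measure"
  assumes S: "closed S" "convex S" and p: "1 \<le> p" and q: "1 \<le> q"
    and zstar: "AE x in P\<^sub>X. zstar x \<in> Z"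
    and cont: "\<And>z. z \<in> Z \<Longrightarrow> continuous_on S (c z)"
    and growth: "\<And>z y. z \<in> Z \<Longrightarrow> y \<in> S \<Longrightarrow> \<bar>c z y\<bar> \<le> B * (1 + norm y powr p)"
    and reg: "(\<exists>L1. (\<forall>z\<in>Z. (L1 z)-lipschitz_on S (c z)) \<and>
            finite_Lq P\<^sub>X q (\<lambda>x. ennreal \<bar>L1 (zstar x)\<bar>))
       \<or> (2 \<le> p \<and> (\<exists>grad L2.
            (\<forall>z\<in>Z. \<forall>y\<in>S. (c z has_derivative (\<lambda>h. grad z y \<bullet> h)) (at y within S)) \<and>
            (\<forall>z\<in>Z. AE x in P\<^sub>X. (\<integral>\<^sup>+y\<in>S. ennreal ((norm (grad z y))\<^sup>2) \<partial>\<mu> x) < \<top>) \<and>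
            (\<forall>z\<in>Z. \<forall>y\<in>S. \<forall>y'\<in>S. norm (grad z y' - grad z y) \<le> L2 z * norm (y' - y)) \<and>
            finite_Lq P\<^sub>X q
              (\<lambda>x. epowr (\<integral>\<^sup>+y\<in>S. ennreal ((norm (grad (zstar x) y))\<^sup>2) \<partial>\<mu> x) (1 / 2)) \<and>
            finite_Lq P\<^sub>X q (\<lambda>x. ennreal \<bar>L2 (zstar x)\<bar>)))"
  obtains H where "finite_Lq P\<^sub>X q H"
    "AE x in P\<^sub>X. \<forall>\<zeta> R Q. 0 < \<zeta> \<longrightarrow> \<zeta> \<le> 1 / 2 \<longrightarrow> R \<in> prob_measures_on S \<longrightarrow>
      (\<integral>\<^sup>+y. ennreal (norm y powr p) \<partial>R) < \<top> \<longrightarrow>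
      Q \<in> wasserstein_ball p S R \<zeta> \<longrightarrow> \<mu> x \<in> wasserstein_ball p S R \<zeta> \<longrightarrow>
      ennreal (expected_cost c S (zstar x) Q - expected_cost c S (zstar x) (\<mu> x)) \<le> H x * ennreal \<zeta>"
  using reg
proof (elim disjE conjE exE)
  fix L1 assume L: "\<forall>z\<in>Z. (L1 z)-lipschitz_on S (c z)"
    and fin: "finite_Lq P\<^sub>X q (\<lambda>x. ennreal \<bar>L1 (zstar x)\<bar>)"
  let ?H = "\<lambda>x. ennreal \<bar>L1 (zstar x)\<bar> * ennreal 8"
  have "finite_Lq P\<^sub>X q ?H" using q fin by (rule finite_Lq_cmult) simp
  \<comment> \<open>The quantifiers over radius, centre and \<open>Q\<close> stand inside
    \<open>AE\<close>: one null set of covariates then serves every sample size and every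
    realization of the data.\<close>
  moreover have "AE x in P\<^sub>X. \<forall>\<zeta> R Q. 0 < \<zeta> \<longrightarrow> \<zeta> \<le> 1 / 2 \<longrightarrow> R \<in> prob_measures_on S \<longrightarrow>
      (\<integral>\<^sup>+y. ennreal (norm y powr p) \<partial>R) < \<top> \<longrightarrow>
      Q \<in> wasserstein_ball p S R \<zeta> \<longrightarrow> \<mu> x \<in> wasserstein_ball p S R \<zeta> \<longrightarrow>
      ennreal (expected_cost c S (zstar x) Q - expected_cost c S (zstar x) (\<mu> x)) \<le> ?H x * ennreal \<zeta>"
    using zstar
  proof (eventually_elim, intro allI impI)
    fix x \<zeta> R Q assume z: "zstar x \<in> Z" and \<zeta>: "0 < \<zeta>" "\<zeta> \<le> 1 / 2"
      and R: "R \<in> prob_measures_on S" "(\<integral>\<^sup>+y. ennreal (norm y powr p) \<partial>R) < \<top>"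
      and Q: "Q \<in> wasserstein_ball p S R \<zeta>" and P: "\<mu> x \<in> wasserstein_ball p S R \<zeta>"
    have "expected_cost c S (zstar x) Q - expected_cost c S (zstar x) (\<mu> x) \<le> 8 * L1 (zstar x) * \<zeta>"
      unfolding expected_cost_def using L z
      by (intro wasserstein_ball_diff_lipschitz[OF S(1) p \<zeta>(1) R Q P cont growth]) auto
    also have "\<dots> \<le> \<bar>L1 (zstar x)\<bar> * 8 * \<zeta>" using \<zeta> by (simp add: mult_right_mono)
    finally show "ennreal (expected_cost c S (zstar x) Q - expected_cost c S (zstar x) (\<mu> x)) \<le> ?H x * ennreal \<zeta>"
      using \<zeta> by (subst ennreal_mult[symmetric], simp, simp)+ (rule ennreal_leI)
  qed
  ultimately show thesis by (rule that)
next
  fix grad L2 assume p2: "2 \<le> p"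
    and der: "\<forall>z\<in>Z. \<forall>y\<in>S. (c z has_derivative (\<lambda>h. grad z y \<bullet> h)) (at y within S)"
    and lip: "\<forall>z\<in>Z. \<forall>y\<in>S. \<forall>y'\<in>S. norm (grad z y' - grad z y) \<le> L2 z * norm (y' - y)"
    and fin1: "finite_Lq P\<^sub>X q
      (\<lambda>x. epowr (\<integral>\<^sup>+y\<in>S. ennreal ((norm (grad (zstar x) y))\<^sup>2) \<partial>\<mu> x) (1 / 2))"
    and fin2: "finite_Lq P\<^sub>X q (\<lambda>x. ennreal \<bar>L2 (zstar x)\<bar>)"
  define I where "I = (\<lambda>x. \<integral>\<^sup>+y\<in>S. ennreal ((norm (grad (zstar x) y))\<^sup>2) \<partial>\<mu> x)"
  let ?H = "\<lambda>x. (epowr (I x) (1 / 2) + ennreal \<bar>L2 (zstar x)\<bar>) * ennreal 16"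
  have "finite_Lq P\<^sub>X q ?H"
    unfolding I_def by (rule finite_Lq_cmult[OF q finite_Lq_add[OF q fin1 fin2]]) simp
  moreover have "AE x in P\<^sub>X. \<forall>\<zeta> R Q. 0 < \<zeta> \<longrightarrow> \<zeta> \<le> 1 / 2 \<longrightarrow> R \<in> prob_measures_on S \<longrightarrow>
      (\<integral>\<^sup>+y. ennreal (norm y powr p) \<partial>R) < \<top> \<longrightarrow>
      Q \<in> wasserstein_ball p S R \<zeta> \<longrightarrow> \<mu> x \<in> wasserstein_ball p S R \<zeta> \<longrightarrow>
      ennreal (expected_cost c S (zstar x) Q - expected_cost c S (zstar x) (\<mu> x)) \<le> ?H x * ennreal \<zeta>"
    using zstar
  proof (eventually_elim, intro allI impI)
    fix x \<zeta> R Q assume z: "zstar x \<in> Z" and \<zeta>: "0 < \<zeta>" "\<zeta> \<le> 1 / 2"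
      and R: "R \<in> prob_measures_on S" "(\<integral>\<^sup>+y. ennreal (norm y powr p) \<partial>R) < \<top>"
      and Q: "Q \<in> wasserstein_ball p S R \<zeta>" and P: "\<mu> x \<in> wasserstein_ball p S R \<zeta>"
    show "ennreal (expected_cost c S (zstar x) Q - expected_cost c S (zstar x) (\<mu> x)) \<le> ?H x * ennreal \<zeta>"
    proof (cases "I x")
      case (real r)
      define k where "k = sqrt r"
      have k: "0 \<le> k" "I x \<le> ennreal (k\<^sup>2)" "epowr (I x) (1 / 2) = ennreal k"
        using real by (auto simp: k_def epowr_ennreal powr_half_sqrt)
      have "expected_cost c S (zstar x) Q - expected_cost c S (zstar x) (\<mu> x) \<le>
          16 * (k + \<bar>L2 (zstar x)\<bar>) * \<zeta>"
        unfolding expected_cost_def using der lip z k(1) k(2)[unfolded I_def]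
        by (intro wasserstein_ball_diff_smooth[OF S p2 \<zeta> R Q P cont growth]) auto
      then have "expected_cost c S (zstar x) Q - expected_cost c S (zstar x) (\<mu> x) \<le>
          (k + \<bar>L2 (zstar x)\<bar>) * 16 * \<zeta>" by (simp add: mult_ac)
      moreover have "?H x * ennreal \<zeta> = ennreal ((k + \<bar>L2 (zstar x)\<bar>) * 16 * \<zeta>)"
        unfolding k(3) using k(1) \<zeta>
        by (simp only: ennreal_mult'' ennreal_plus abs_ge_zero zero_le_numeral less_imp_le)
      ultimately show ?thesis by (auto intro: ennreal_leI)
    next
      \<comment> \<open>An infinite gradient moment makes \<open>?H x\<close> infinite, and the
        product with the positive \<open>\<zeta>\<close> stays infinite.\<close>
      case top
      then show ?thesis using \<zeta> by (simp add: ennreal_top_mult)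
    qed
  qed
  ultimately show thesis by (rule that)
qed

section \<open>Optimal values of the true and the worst-case problem\<close>

lemma is_arg_min_INF:
  fixes f :: "'a \<Rightarrow> real"
  assumes "is_arg_min f (\<lambda>z. z \<in> Z) z0" shows "(INF z\<in>Z. f z) = f z0"
  using assms by (intro cInf_eq_minimum) (auto simp: is_arg_min_linorder)

text \<open>Both \<open>E zD P\<close> and the worst-case optimal value lie between
  \<open>E zs P\<close> and the worst case of \<open>zs\<close>, whose gap is at most
  \<open>K\<close>. The lower bound for the worst-case value uses \<open>P \<in> amb\<close>;
  boundedness makes the real supremum an upper bound. \<open>K\<close> may be infinite, as the
  modulus \<open>H\<close> may be at some covariates.\<close>

lemma worst_case_sandwich:
  fixes E :: "'z \<Rightarrow> 'm \<Rightarrow> real"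
  assumes P: "P \<in> amb" and bdd: "\<And>z. z \<in> Z \<Longrightarrow> bdd_above (E z ` amb)"
    and zD: "is_arg_min (\<lambda>z. SUP Q\<in>amb. E z Q) (\<lambda>z. z \<in> Z) zD"
    and zs: "is_arg_min (\<lambda>z. E z P) (\<lambda>z. z \<in> Z) zs"
    and K: "\<And>Q. Q \<in> amb \<Longrightarrow> ennreal (E zs Q - E zs P) \<le> K"
  shows "ennreal \<bar>(INF z\<in>Z. SUP Q\<in>amb. E z Q) - (INF z\<in>Z. E z P)\<bar> \<le> K"
    and "ennreal \<bar>E zD P - (INF z\<in>Z. E z P)\<bar> \<le> K"
proof -
  have Z: "zD \<in> Z" "zs \<in> Z" using zD zs by (auto simp: is_arg_min_def)
  have 1: "E zs P \<le> E zD P" using zs Z by (auto simp: is_arg_min_linorder)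
  have 2: "E zD P \<le> (SUP Q\<in>amb. E zD Q)" using P bdd[OF Z(1)] by (rule cSUP_upper)
  have 3: "(SUP Q\<in>amb. E zD Q) \<le> (SUP Q\<in>amb. E zs Q)" using zD Z by (auto simp: is_arg_min_linorder)
  have 4: "ennreal ((SUP Q\<in>amb. E zs Q) - E zs P) \<le> K"
  proof (cases K)
    case (real k)
    have "(SUP Q\<in>amb. E zs Q) \<le> E zs P + k"
      using P
    proof (intro cSUP_least)
      fix Q assume "Q \<in> amb"
      from K[OF this] have "E zs Q - E zs P \<le> k"
        using real by (simp add: ennreal_le_iff)
      then show "E zs Q \<le> E zs P + k" by simp
    qed auto
    then show ?thesis unfolding real by (intro ennreal_leI) simp
  qed simp
  have "\<bar>(SUP Q\<in>amb. E zD Q) - E zs P\<bar> \<le> (SUP Q\<in>amb. E zs Q) - E zs P"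
    "\<bar>E zD P - E zs P\<bar> \<le> (SUP Q\<in>amb. E zs Q) - E zs P"
    using 1 2 3 by auto
  from this[THEN ennreal_leI] 4
  show "ennreal \<bar>(INF z\<in>Z. SUP Q\<in>amb. E z Q) - (INF z\<in>Z. E z P)\<bar> \<le> K"
    and "ennreal \<bar>E zD P - (INF z\<in>Z. E z P)\<bar> \<le> K"
    unfolding is_arg_min_INF[OF zD] is_arg_min_INF[OF zs] by (auto intro: order_trans)
qed

section \<open>The concentration part of the radius\<close>

text \<open>With \<open>r = ln (2 * C / \<alpha>) / (c0 * n)\<close>, the cases of
  \<open>kappa2\<close> are \<open>r \<le> 1\<close> and \<open>r > 1\<close>. A positive power
  stays on the same side of \<open>1\<close>, so the corresponding case of \<open>conc_bound\<close>
  applies; its exponent is the reciprocal one, and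
  \<open>C * exp (- c0 * n * r) = \<alpha> / 2\<close> remains.\<close>

lemma kappa2_properties:
  assumes p: "1 \<le> p" and a: "p < a" and dy: "0 < dy" and C: "1 \<le> C" and c0: "0 < c0" and n: "1 \<le> n"
    and \<alpha>: "0 < \<alpha>" "\<alpha> < 1"
  shows "0 < kappa2 p a dy C c0 n \<alpha>"
    and "conc_bound p a dy C c0 n (kappa2 p a dy C c0 n \<alpha>) = \<alpha> / 2"
proof -
  define r where "r = ln (2 * C / \<alpha>) / (c0 * real n)"
  have "1 < 2 * C / \<alpha>" using C \<alpha> by (simp add: field_simps)
  then have r: "0 < r" using c0 n unfolding r_def by (intro divide_pos_pos ln_gt_zero) auto
  have cr: "c0 * real n * r = ln (2 * C / \<alpha>)" using c0 n by (simp add: r_def)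
  have case1: "ln (2 * C / \<alpha>) / c0 \<le> real n \<longleftrightarrow> r \<le> 1"
    using c0 n by (simp add: r_def field_simps)
  have end1: "C * exp (- c0 * real n * r) = \<alpha> / 2"
  proof -
    have "exp (- c0 * real n * r) = exp (- ln (2 * C / \<alpha>))" unfolding cr[symmetric] by simp
    also have "\<dots> = \<alpha> / (2 * C)" using C \<alpha> by (simp add: exp_minus)
    finally show ?thesis using C by simp
  qed
  show "0 < kappa2 p a dy C c0 n \<alpha>"
    using r unfolding kappa2_def r_def[symmetric] by auto
  show "conc_bound p a dy C c0 n (kappa2 p a dy C c0 n \<alpha>) = \<alpha> / 2"
  proof (cases "r \<le> 1")
    case True
    define s where "s = min (p / real dy) (1 / 2)"
    have k: "kappa2 p a dy C c0 n \<alpha> = r powr s"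
      using True unfolding kappa2_def case1 r_def[symmetric] s_def by simp
    have s: "0 < s" "s * max (real dy / p) 2 = 1"
      using p dy unfolding s_def by (auto simp: min_def max_def field_simps)
    have "r powr s \<le> 1" using True r s by (simp add: powr_le1)
    then show ?thesis using end1 r s unfolding k conc_bound_def by (simp add: powr_powr)
  next
    case False
    have k: "kappa2 p a dy C c0 n \<alpha> = r powr (p / a)"
      using False unfolding kappa2_def case1 r_def[symmetric] by simp
    have "1 < r powr (p / a)" using False p a by (intro gr_one_powr) auto
    then show ?thesis using end1 r p a unfolding k conc_bound_def by (simp add: powr_powr)
  qed
qed

section \<open>Order in probability from bounds off vanishing events\<close>

text \<open>The ratio of \<open>V\<close> to \<open>W\<close> can exceed \<open>K\<close> only
  inside \<open>A n\<close>, up to a null set, and these events have probabilities tending to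
  zero.\<close>

lemma bigOp_of_AE_bound:
  assumes "prob_space M" and V: "\<And>n. n \<ge> 1 \<Longrightarrow> V n \<in> borel_measurable M"
    and W: "\<And>n. n \<ge> 1 \<Longrightarrow> 0 < W n" and K: "0 \<le> K"
    and bound: "\<forall>\<^sub>F n in sequentially. AE \<omega> in M. \<omega> \<notin> A n \<longrightarrow> V n \<omega> \<le> ennreal K * ennreal (W n)"
    and A: "\<And>n. n \<ge> 1 \<Longrightarrow> A n \<in> sets M" "\<And>n. n \<ge> 1 \<Longrightarrow> measure M (A n) \<le> \<beta> n" and \<beta>: "\<beta> \<longlonglongrightarrow> 0"
  shows "bigOp M V W"
proof -
  interpret prob_space M by fact
  define R where "R = (\<lambda>n \<omega>. V n \<omega> / ennreal (W n))"
  have Rm: "R n \<in> borel_measurable M" if "n \<ge> 1" for n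
    unfolding R_def using V[OF that] by measurable
  have "\<exists>K::real. \<forall>\<^sub>F n in sequentially. measure M {\<omega> \<in> space M. R n \<omega> > ennreal K} \<le> \<delta>"
    if "0 < \<delta>" for \<delta>
  \<comment> \<open>The same \<open>K\<close> works for every \<delta>; only the threshold on
    \<open>n\<close> depends on \<delta>.\<close>
  proof (intro exI)
    have "\<forall>\<^sub>F n in sequentially. \<beta> n < \<delta>" using \<beta> that by (rule order_tendstoD)
    then show "\<forall>\<^sub>F n in sequentially. measure M {\<omega> \<in> space M. R n \<omega> > ennreal K} \<le> \<delta>"
      using bound eventually_ge_at_top[of 1]
    proof eventually_elim
      case (elim n)
      from elim(2) have "AE \<omega> in M. \<omega> \<in> {\<omega> \<in> space M. R n \<omega> > ennreal K} \<longrightarrow> \<omega> \<in> A n"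
      proof eventually_elim
        case (elim \<omega>)
        have "R n \<omega> \<le> ennreal K" if "\<omega> \<notin> A n"
          using elim that W[OF \<open>1 \<le> n\<close>] unfolding R_def
          by (intro divide_le_posI_ennreal) (auto simp: mult.commute)
        then show ?case by (blast dest: leD)
      qed
      then have "measure M {\<omega> \<in> space M. R n \<omega> > ennreal K} \<le> measure M (A n)"
        using A(1) elim by (intro finite_measure_mono_AE) auto
      then show ?case using A(2) elim by force
    qed
  qed
  \<comment> \<open>Division by \<open>W n\<close> is undone by multiplication even where
    \<open>V\<close> is infinite, because \<open>W n\<close> is positive and finite.\<close>
  moreover have "V n \<omega> = R n \<omega> * ennreal (W n)" if "n \<ge> 1" for n \<omega>
    using W[OF that] by (simp add: R_def ennreal_divide_times ennreal_times_divide mult_divide_eq_ennreal ennreal_mult_divide_eq)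
  ultimately show ?thesis
    using Rm unfolding bigOp_def bounded_in_prob_def by blast
qed

subsection \<open>The residual-based estimator\<close>

text \<open>By disintegration, the null probability that \<open>Y\<close> misses its support is the
  average over \<open>x\<close> of the conditional masses off the support, so almost all of these
  vanish.\<close>

lemma AE_cond_law_in_support:
  fixes f :: "'x::euclidean_space \<Rightarrow> 'y::euclidean_space"
  assumes M: "prob_space M" and ind: "indep_rvs M X \<epsilon>"
    and [measurable]: "f \<in> borel_measurable borel" "Y \<in> borel_measurable M"
    and Y: "\<And>\<omega>. \<omega> \<in> space M \<Longrightarrow> Y \<omega> = f (X \<omega>) + \<epsilon> \<omega>"
  shows "AE x in distr M borel X. AE y in cond_law M f \<epsilon> x. y \<in> msupport (distr M borel Y)"
proof -
  interpret prob_space M by fact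
  have [measurable]: "X \<in> borel_measurable M" "\<epsilon> \<in> borel_measurable M"
    using ind by (auto simp: indep_rvs_def)
  define N where "N = - msupport (distr M borel Y)"
  have N[measurable]: "N \<in> sets borel" unfolding N_def by (simp add: borel_closed closed_msupport)
  have "AE y in distr M borel Y. y \<notin> N" unfolding N_def using AE_msupport[of "distr M borel Y"] by simp
  then have "AE \<omega> in M. Y \<omega> \<notin> N" by (subst (asm) AE_distr_iff) auto
  then have "emeasure M {\<omega> \<in> space M. Y \<omega> \<in> N} = 0" by (simp add: AE_iff_measurable[OF _ refl])
  also have "{\<omega> \<in> space M. Y \<omega> \<in> N} = {\<omega> \<in> space M. X \<omega> \<in> UNIV \<and> f (X \<omega>) + \<epsilon> \<omega> \<in> N}"
    using Y by auto
  also have "emeasure M \<dots> = (\<integral>\<^sup>+x. emeasure (cond_law M f \<epsilon> x) N \<partial>distr M borel X)"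
    by (subst cond_law_disintegration[OF M ind]) auto
  \<comment> \<open>Written as an integral with parameter \<open>x\<close>, the mass is visibly
    measurable in \<open>x\<close>.\<close>
  also have "(\<lambda>x. emeasure (cond_law M f \<epsilon> x) N) = (\<lambda>x. \<integral>\<^sup>+\<omega>. indicator N (f x + \<epsilon> \<omega>) \<partial>M)"
  proof
    fix x
    have "emeasure (cond_law M f \<epsilon> x) N = (\<integral>\<^sup>+y. indicator N y \<partial>cond_law M f \<epsilon> x)"
      by (simp add: cond_law_def)
    also have "\<dots> = (\<integral>\<^sup>+\<omega>. indicator N (f x + \<epsilon> \<omega>) \<partial>M)"
      unfolding cond_law_def by (rule nn_integral_distr) measurable
    finally show "emeasure (cond_law M f \<epsilon> x) N = \<dots>" .
  qed
  finally have "AE x in distr M borel X. (\<integral>\<^sup>+\<omega>. indicator N (f x + \<epsilon> \<omega>) \<partial>M) = 0"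
    by (subst (asm) nn_integral_0_iff_AE) auto
  then show ?thesis
  proof eventually_elim
    case (elim x)
    then have "AE \<omega> in M. (indicator N (f x + \<epsilon> \<omega>) :: ennreal) = 0"
      by (subst (asm) nn_integral_0_iff_AE) auto
    then have "AE \<omega> in M. f x + \<epsilon> \<omega> \<notin> N" by (auto elim!: eventually_mono simp: indicator_def split: if_splits)
    then have "AE y in cond_law M f \<epsilon> x. y \<notin> N"
      unfolding cond_law_def by (subst AE_distr_iff) auto
    then show ?case by (simp add: N_def)
  qed
qed

text \<open>Fubini for null sets exchanges the two almost-everywhere quantifiers. The sampled error
  \<open>e\<close> stands in for \<open>\<epsilon>\<close> because the laws agree, so almost every
  realized error shifts \<open>f x\<close> into \<open>S\<close> for almost all
  \<open>x\<close>.\<close>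

lemma AE_shift_in_support:
  fixes f :: "'x::euclidean_space \<Rightarrow> 'y::euclidean_space"
  assumes M: "prob_space M" and P: "prob_space P" "sets P = sets borel"
    and [measurable]: "f \<in> borel_measurable borel" "\<epsilon> \<in> borel_measurable M" "e \<in> borel_measurable M"
    and S: "S \<in> sets borel" and distr: "distr M borel e = distr M borel \<epsilon>"
    and AE: "AE x in P. AE y in cond_law M f \<epsilon> x. y \<in> S"
  shows "AE \<omega> in M. AE x in P. f x + e \<omega> \<in> S"
proof -
  interpret prob_space M by fact
  interpret P: prob_space P by fact
  interpret pair_sigma_finite P M ..
  note [measurable_cong] = P(2)
  note [measurable] = S
  have "AE x in P. AE \<omega> in M. f x + e \<omega> \<in> S"
    using AE
  proof eventually_elim
    case (elim x)
    then have "AE \<omega> in M. f x + \<epsilon> \<omega> \<in> S"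
      unfolding cond_law_def by (subst (asm) AE_distr_iff) auto
    then have "AE v in distr M borel \<epsilon>. f x + v \<in> S"
      by (subst AE_distr_iff) auto
    then show ?case
      unfolding distr[symmetric] by (subst (asm) AE_distr_iff) auto
  qed
  moreover have "{u \<in> space (P \<Otimes>\<^sub>M M). f (fst u) + e (snd u) \<in> S} \<in> sets (P \<Otimes>\<^sub>M M)"
    by measurable
  ultimately show ?thesis using AE_commute[of "\<lambda>x \<omega>. f x + e \<omega> \<in> S"] by simp
qed

text \<open>This is what lets concentration at one reference covariate \<open>x0\<close> serve all
  \<open>x\<close>.\<close>

lemma cond_law_translate:
  fixes f :: "'x \<Rightarrow> 'y::euclidean_space"
  assumes [measurable]: "\<epsilon> \<in> borel_measurable M"
  shows "cond_law M f \<epsilon> x = distr (cond_law M f \<epsilon> x0) borel (\<lambda>y. y + (f x - f x0))"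
  unfolding cond_law_def by (subst distr_distr) (auto simp: comp_def algebra_simps)

lemma ER_empirical_properties:
  assumes S: "closed S" "S \<noteq> {}" and n: "n \<ge> 1"
  shows "ER_empirical S F n d x \<in> prob_measures_on S"
    and "(\<integral>\<^sup>+y. ennreal (norm y powr p) \<partial>ER_empirical S F n d x) < \<top>"
proof -
  have "AE y in ER_empirical S F n d x. y \<in> S"
    unfolding ER_empirical_def using S
    by (intro AE_empirical closest_point_in_set) (auto simp: pred_def)
  then show "ER_empirical S F n d x \<in> prob_measures_on S"
    using prob_space_empirical[OF n] unfolding prob_measures_on_def ER_empirical_def by simp
  show "(\<integral>\<^sup>+y. ennreal (norm y powr p) \<partial>ER_empirical S F n d x) < \<top>"
    unfolding ER_empirical_def
    by (subst nn_integral_empirical) (auto simp: ennreal_mult_less_top)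
qed

text \<open>The true atom lies in \<open>S\<close> and is its own projection, so nonexpansiveness
  reduces the claim to the unprojected points.\<close>

lemma ER_atom_close:
  fixes f :: "'x \<Rightarrow> 'y::euclidean_space"
  assumes S: "closed S" "S \<noteq> {}" "convex S" and i: "i \<in> {1..n}"
    and x: "norm (f x - F n (dataset ys xs n \<omega>) x) \<le> \<kappa>"
    and xi: "norm (f (xs i \<omega>) - F n (dataset ys xs n \<omega>) (xs i \<omega>)) \<le> \<kappa>"
    and mem: "f x + (ys i \<omega> - f (xs i \<omega>)) \<in> S"
  shows "norm (closest_point S (F n (dataset ys xs n \<omega>) x + residual F n (dataset ys xs n \<omega>) i)
      - (f x + (ys i \<omega> - f (xs i \<omega>)))) \<le> 2 * \<kappa>"
proof -
  let ?d = "dataset ys xs n \<omega>" and ?e = "f x + (ys i \<omega> - f (xs i \<omega>))"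
  have d: "?d i = (ys i \<omega>, xs i \<omega>)" using i by (simp add: dataset_def)
  have "dist (closest_point S (F n ?d x + residual F n ?d i)) (closest_point S ?e) \<le>
      dist (F n ?d x + residual F n ?d i) ?e"
    using S by (intro closest_point_lipschitz)
  \<comment> \<open>The response \<open>ys i \<omega>\<close> cancels; what remains is the
    regression error at the sampled covariate minus the one at \<open>x\<close>.\<close>
  also have "\<dots> = norm ((f (xs i \<omega>) - F n ?d (xs i \<omega>)) - (f x - F n ?d x))"
    by (simp add: dist_norm residual_def d algebra_simps)
  also have "\<dots> \<le> 2 * \<kappa>" using norm_triangle_ineq4[of "f (xs i \<omega>) - F n ?d (xs i \<omega>)" "f x - F n ?d x"] x xi by simp
  finally show ?thesis by (simp add: closest_point_self[OF mem] dist_norm)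
qed

section \<open>Assembly of the two convergence rates\<close>

theorem theorem11:
  fixes M :: "'w measure"
    and X :: "'w \<Rightarrow> 'x::euclidean_space"
    and Y \<epsilon> :: "'w \<Rightarrow> 'y::euclidean_space"
    and fstar :: "'x \<Rightarrow> 'y"
    and Xsp :: "'x set" and Ysp :: "'y set" and Z :: "'z::euclidean_space set"
    and P\<^sub>X :: "'x measure" and P\<^sub>Y\<^sub>X :: "'x \<Rightarrow> 'y measure"
    and c :: "'z \<Rightarrow> 'y \<Rightarrow> real"
    and g :: "'z \<Rightarrow> 'x \<Rightarrow> real" and vstar :: "'x \<Rightarrow> real" and zstar :: "'x \<Rightarrow> 'z"
    and xs :: "nat \<Rightarrow> 'w \<Rightarrow> 'x" and ys es :: "nat \<Rightarrow> 'w \<Rightarrow> 'y"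
    and D :: "nat \<Rightarrow> 'w \<Rightarrow> nat \<Rightarrow> 'y \<times> 'x"
    and fhat :: "nat \<Rightarrow> (nat \<Rightarrow> 'y \<times> 'x) \<Rightarrow> 'x \<Rightarrow> 'y"
    and p a C c0 B :: real and q :: ennreal
    and \<kappa> :: "nat \<Rightarrow> real \<Rightarrow> real" and \<alpha> \<zeta> :: "nat \<Rightarrow> real"
    and amb :: "nat \<Rightarrow> 'w \<Rightarrow> 'x \<Rightarrow> 'y measure set"
    and vDRO :: "nat \<Rightarrow> 'w \<Rightarrow> 'x \<Rightarrow> real" and zDRO :: "nat \<Rightarrow> 'w \<Rightarrow> 'x \<Rightarrow> 'z"
  \<comment> \<open>model\<close>
  assumes "prob_space M"
    and "X \<in> borel_measurable M" and "Y \<in> borel_measurable M" and "\<epsilon> \<in> borel_measurable M"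
    and "fstar \<in> borel_measurable borel"
    and "\<And>\<omega>. \<omega> \<in> space M \<Longrightarrow> Y \<omega> = fstar (X \<omega>) + \<epsilon> \<omega>"
    and "integrable M \<epsilon>" and "(LINT \<omega>|M. \<epsilon> \<omega>) = 0"
    and "indep_rvs M X \<epsilon>"
    and "P\<^sub>X = distr M borel X" and "Xsp = msupport P\<^sub>X"
    and "Ysp = msupport (distr M borel Y)" and "Ysp \<noteq> {}" and "convex Ysp"
    and "P\<^sub>Y\<^sub>X = cond_law M fstar \<epsilon>"
  \<comment> \<open>true problem\<close>
    and "Z \<noteq> {}" and "compact Z"
    and "\<And>z x. g z x = expected_cost c Ysp z (P\<^sub>Y\<^sub>X x)"
    and "\<And>z. z \<in> Z \<Longrightarrow> AE x in P\<^sub>X. set_integrable (P\<^sub>Y\<^sub>X x) Ysp (c z)"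
    and "AE x in P\<^sub>X. lsc_on Z (\<lambda>z. g z x)"
    and "\<And>x. vstar x = (INF z\<in>Z. g z x)" and "vstar \<in> borel_measurable P\<^sub>X"
    and "zstar \<in> borel_measurable P\<^sub>X"
    and "AE x in P\<^sub>X. is_arg_min (\<lambda>z. g z x) (\<lambda>z. z \<in> Z) (zstar x)"
  \<comment> \<open>data and regression estimate\<close>
    and "\<And>i. i \<ge> 1 \<Longrightarrow> xs i \<in> borel_measurable M" and "\<And>i. i \<ge> 1 \<Longrightarrow> ys i \<in> borel_measurable M"
    and "\<And>i. i \<ge> 1 \<Longrightarrow> AE \<omega> in M. xs i \<omega> \<in> Xsp"
    and "\<And>i \<omega>. es i \<omega> = ys i \<omega> - fstar (xs i \<omega>)"
    and "D = dataset ys xs"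
    and "\<And>n. n \<ge> 1 \<Longrightarrow>
      (\<lambda>(d, x). fhat n d x) \<in> borel_measurable (PiM {1..n} (\<lambda>_. borel) \<Otimes>\<^sub>M borel)"
  \<comment> \<open>exponents, (i), (ii)\<close>
    and "1 \<le> p" and "p \<noteq> real DIM('y) / 2" and "1 \<le> q"
    and "p < a" and "integrable M (\<lambda>\<omega>. exp (norm (\<epsilon> \<omega>) powr a))"
    and "\<And>n. n \<ge> 1 \<Longrightarrow>
      (\<lambda>\<omega>. SUP x\<in>Xsp. ennreal (norm (fstar x - fhat n (D n \<omega>) x))) \<in> borel_measurable M"
    and "\<And>n \<beta>. n \<ge> 1 \<Longrightarrow> 0 < \<beta> \<Longrightarrow> \<beta> < 1 \<Longrightarrow> \<kappa> n \<beta> > 0 \<and>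
      measure M {\<omega> \<in> space M. (SUP x\<in>Xsp. ennreal (norm (fstar x - fhat n (D n \<omega>) x)))
                                 > ennreal (\<kappa> n \<beta>)} \<le> \<beta>"
  \<comment> \<open>(iii)\<close>
    and "\<And>y. y \<in> Ysp \<Longrightarrow> lsc_on Z (\<lambda>z. c z y)"
    and "\<And>z. z \<in> Z \<Longrightarrow> continuous_on Ysp (c z)"
    and "0 \<le> B"
    and "\<And>z y. z \<in> Z \<Longrightarrow> y \<in> Ysp \<Longrightarrow> \<bar>c z y\<bar> \<le> B * (1 + norm y powr p)"
  \<comment> \<open>measure concentration inequality with its constants\<close>
    and "1 \<le> C" and "0 < c0"
    and "\<And>n x. n \<ge> 1 \<Longrightarrow> x \<in> Xsp \<Longrightarrow>
      (\<lambda>\<omega>. wasserstein p (empirical n (\<lambda>i. fstar x + es i \<omega>)) (P\<^sub>Y\<^sub>X x)) \<in> borel_measurable M"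
    and "\<And>n x t. n \<ge> 1 \<Longrightarrow> x \<in> Xsp \<Longrightarrow> 0 < t \<Longrightarrow>
      measure M {\<omega> \<in> space M.
        wasserstein p (empirical n (\<lambda>i. fstar x + es i \<omega>)) (P\<^sub>Y\<^sub>X x) \<ge> ennreal t}
      \<le> conc_bound p a DIM('y) C c0 n t"
  \<comment> \<open>(iv)\<close>
    and "\<And>n. n \<ge> 1 \<Longrightarrow> 0 < \<alpha> n \<and> \<alpha> n < 1" and "summable \<alpha>"
    and "\<And>n. \<zeta> n = radius \<kappa> p a DIM('y) C c0 n (\<alpha> n)"
    and "\<zeta> \<longlonglongrightarrow> 0"
  \<comment> \<open>(v)\<close>
    and "prob_space.indep_vars M (\<lambda>_. borel) es {1..}"
    and "\<And>i. i \<ge> 1 \<Longrightarrow> distr M borel (es i) = distr M borel \<epsilon>"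
  \<comment> \<open>(vi)\<close>
    and "(\<exists>L1. (\<forall>z\<in>Z. (L1 z)-lipschitz_on Ysp (c z)) \<and>
            finite_Lq P\<^sub>X q (\<lambda>x. ennreal \<bar>L1 (zstar x)\<bar>))
       \<or> (2 \<le> p \<and> (\<exists>grad L2.
            (\<forall>z\<in>Z. \<forall>y\<in>Ysp. (c z has_derivative (\<lambda>h. grad z y \<bullet> h)) (at y within Ysp)) \<and>
            (\<forall>z\<in>Z. AE x in P\<^sub>X. (\<integral>\<^sup>+y\<in>Ysp. ennreal ((norm (grad z y))\<^sup>2) \<partial>P\<^sub>Y\<^sub>X x) < \<top>) \<and>
            (\<forall>z\<in>Z. \<forall>y\<in>Ysp. \<forall>y'\<in>Ysp. norm (grad z y' - grad z y) \<le> L2 z * norm (y' - y)) \<and>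
            finite_Lq P\<^sub>X q
              (\<lambda>x. epowr (\<integral>\<^sup>+y\<in>Ysp. ennreal ((norm (grad (zstar x) y))\<^sup>2) \<partial>P\<^sub>Y\<^sub>X x) (1 / 2)) \<and>
            finite_Lq P\<^sub>X q (\<lambda>x. ennreal \<bar>L2 (zstar x)\<bar>)))"
  \<comment> \<open>ER-DRO problem\<close>
    and "\<And>n \<omega> x. amb n \<omega> x =
      wasserstein_ball p Ysp (ER_empirical Ysp fhat n (D n \<omega>) x) (\<zeta> n)"
    and "\<And>n \<omega> x z. n \<ge> 1 \<Longrightarrow> \<omega> \<in> space M \<Longrightarrow> x \<in> Xsp \<Longrightarrow> z \<in> Z \<Longrightarrow>
      bdd_above (expected_cost c Ysp z ` amb n \<omega> x)"
    and "\<And>n \<omega> x. n \<ge> 1 \<Longrightarrow> \<omega> \<in> space M \<Longrightarrow> x \<in> Xsp \<Longrightarrow>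
      lsc_on Z (worst_case_cost c Ysp (amb n \<omega> x))"
    and "\<And>n \<omega> x. vDRO n \<omega> x = (INF z\<in>Z. worst_case_cost c Ysp (amb n \<omega> x) z)"
    and "\<And>n \<omega> x. n \<ge> 1 \<Longrightarrow> \<omega> \<in> space M \<Longrightarrow> x \<in> Xsp \<Longrightarrow>
      is_arg_min (worst_case_cost c Ysp (amb n \<omega> x)) (\<lambda>z. z \<in> Z) (zDRO n \<omega> x)"
    and "\<And>n. n \<ge> 1 \<Longrightarrow> (\<lambda>(\<omega>, x). vDRO n \<omega> x) \<in> borel_measurable (M \<Otimes>\<^sub>M P\<^sub>X)"
    and "\<And>n. n \<ge> 1 \<Longrightarrow> (\<lambda>(\<omega>, x). zDRO n \<omega> x) \<in> borel_measurable (M \<Otimes>\<^sub>M P\<^sub>X)"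
    and "\<And>n. n \<ge> 1 \<Longrightarrow> (\<lambda>(\<omega>, x). g (zDRO n \<omega> x) x) \<in> borel_measurable (M \<Otimes>\<^sub>M P\<^sub>X)"
  shows "bigOp M (\<lambda>n \<omega>. Lq_norm P\<^sub>X q (\<lambda>x. ennreal \<bar>vDRO n \<omega> x - vstar x\<bar>)) \<zeta> \<and>
         bigOp M (\<lambda>n \<omega>. Lq_norm P\<^sub>X q (\<lambda>x. ennreal \<bar>g (zDRO n \<omega> x) x - vstar x\<bar>)) \<zeta>"
proof -
  note p = assms(31) and q = assms(33) and a = assms(34) and amb = assms(53)
    and P\<^sub>X = assms(10) and Xsp = assms(11) and Ysp = assms(12) and P\<^sub>Y\<^sub>X = assms(15)
    and \<zeta>_eq = assms(48) and \<alpha> = assms(46)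
  note [measurable] = assms(2-5) and assms(25,26)
  interpret prob_space M by fact
  have PX: "prob_space P\<^sub>X" "sets P\<^sub>X = sets borel" unfolding P\<^sub>X by (auto intro: prob_space_distr)
  interpret PX: prob_space P\<^sub>X by fact
  have S: "closed Ysp" "Ysp \<noteq> {}" "convex Ysp" using assms(13,14) by (auto simp: Ysp closed_msupport)
  have es[measurable]: "es i \<in> borel_measurable M" if "i \<ge> 1" for i
    using assms(25,26)[OF that] unfolding assms(28)[abs_def] by measurable
  have AE_X: "AE x in P\<^sub>X. x \<in> Xsp" unfolding Xsp using PX(2) by (rule AE_msupport)
  \<comment> \<open>Since \<open>x\<close> lies in the support almost surely, the support is
    nonempty and offers the reference covariate \<open>x0\<close>.\<close>
  have "\<not> (AE x in P\<^sub>X. False)" by (simp add: PX.AE_False)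
  then obtain x0 where x0: "x0 \<in> Xsp" using AE_X by (metis (mono_tags, lifting) eventually_mono)
  have AE_law: "AE x in P\<^sub>X. AE y in P\<^sub>Y\<^sub>X x. y \<in> Ysp"
    unfolding P\<^sub>X P\<^sub>Y\<^sub>X Ysp by (rule AE_cond_law_in_support) (use assms in auto)
  have AE_es: "AE \<omega> in M. AE x in P\<^sub>X. fstar x + es i \<omega> \<in> Ysp" if "i \<ge> 1" for i
    by (rule AE_shift_in_support[OF assms(1) PX assms(5,4) es[OF that] borel_closed[OF S(1)] assms(51)[OF that]])
      (use AE_law[unfolded P\<^sub>Y\<^sub>X] in assumption)
  \<comment> \<open>Countably many indices, hence a single almost sure event. Sampled covariates
    have to lie in \<open>Xsp\<close> because the regression error is controlled only there.\<close>
  have AE_data: "AE \<omega> in M. \<forall>i. i \<ge> 1 \<longrightarrow> xs i \<omega> \<in> Xsp \<and> (AE x in P\<^sub>X. fstar x + es i \<omega> \<in> Ysp)"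
    using assms(27) AE_es by (auto simp: AE_all_countable)
  have sets_law: "sets (P\<^sub>Y\<^sub>X x) = sets borel" and prob_law: "prob_space (P\<^sub>Y\<^sub>X x)" for x
    unfolding P\<^sub>Y\<^sub>X cond_law_def by (auto intro!: prob_space_distr)
  have AE_z: "AE x in P\<^sub>X. zstar x \<in> Z"
    using assms(24) by eventually_elim (simp add: is_arg_min_def)

  define \<kappa>1 where "\<kappa>1 n = \<kappa> n (\<alpha> n / 4)" for n
  define \<kappa>2 where "\<kappa>2 n = kappa2 p a DIM('y) C c0 n (\<alpha> n)" for n
  have \<kappa>1: "0 < \<kappa>1 n" "measure M {\<omega> \<in> space M. (SUP x\<in>Xsp. ennreal (norm (fstar x - fhat n (D n \<omega>) x)))
      > ennreal (\<kappa>1 n)} \<le> \<alpha> n / 4" if "n \<ge> 1" for n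
    using assms(37)[of n "\<alpha> n / 4"] \<alpha>[OF that] that by (auto simp: \<kappa>1_def)
  have \<kappa>2: "0 < \<kappa>2 n" "conc_bound p a DIM('y) C c0 n (\<kappa>2 n) = \<alpha> n / 2" if "n \<ge> 1" for n
    unfolding \<kappa>2_def using \<alpha>[OF that] that p a assms(42,43)
      kappa2_properties[of p a "DIM('y)" C c0 n "\<alpha> n"] by auto
  have \<zeta>: "\<zeta> n = 2 * \<kappa>1 n + \<kappa>2 n" for n by (simp add: \<zeta>_eq radius_def \<kappa>1_def \<kappa>2_def)
  have \<zeta>_pos: "0 < \<zeta> n" if "n \<ge> 1" for n using \<kappa>1(1)[OF that] \<kappa>2(1)[OF that] by (simp add: \<zeta>)

  define W0 where "W0 n \<omega> = wasserstein p (empirical n (\<lambda>i. fstar x0 + es i \<omega>)) (P\<^sub>Y\<^sub>X x0)" for n \<omega>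
  \<comment> \<open>The regression event has probability at most \<open>\<alpha> n / 4\<close> by
    the choice of \<open>\<kappa>1\<close>. The concentration event, taken at \<open>x0\<close>
    only, has probability at most \<open>\<alpha> n / 2\<close>, the value of
    \<open>conc_bound\<close> at \<open>\<kappa>2 n\<close>.\<close>
  define bad where "bad n = {\<omega> \<in> space M. (SUP x\<in>Xsp. ennreal (norm (fstar x - fhat n (D n \<omega>) x)))
      > ennreal (\<kappa>1 n)} \<union> {\<omega> \<in> space M. W0 n \<omega> \<ge> ennreal (\<kappa>2 n)}" for n
  have [measurable]: "W0 n \<in> borel_measurable M" if "n \<ge> 1" for n
    unfolding W0_def[abs_def] using assms(44)[OF that x0] .
  have bad_sets: "bad n \<in> sets M" if "n \<ge> 1" for n
    unfolding bad_def using assms(36)[OF that] that by measurable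
  have bad_le: "measure M (bad n) \<le> \<alpha> n / 4 + \<alpha> n / 2" if "n \<ge> 1" for n
  proof -
    have "measure M {\<omega> \<in> space M. W0 n \<omega> \<ge> ennreal (\<kappa>2 n)} \<le> \<alpha> n / 2"
      using assms(45)[OF that x0 \<kappa>2(1)[OF that]] unfolding W0_def \<kappa>2(2)[OF that] .
    with \<kappa>1(2)[OF that] show ?thesis
      unfolding bad_def using assms(36)[OF that] that
      by (intro order_trans[OF measure_Un_le] add_mono) auto
  qed
  have bad_lim: "(\<lambda>n. \<alpha> n / 4 + \<alpha> n / 2) \<longlonglongrightarrow> 0"
    using summable_LIMSEQ_zero[OF assms(47)] by (auto intro!: tendsto_eq_intros)

  \<comment> \<open>Deterministic core, for a fixed realization of the data. Gluing adds the
    atomwise displacement \<open>2 * \<kappa>1 n\<close> to the concentration distance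
    \<open>\<kappa>2 n\<close>, and the sum is exactly \<open>\<zeta> n\<close>.\<close>
  have law_in_amb: "P\<^sub>Y\<^sub>X x \<in> amb n \<omega> x"
    if n: "n \<ge> 1" and \<omega>: "\<omega> \<in> space M" "\<omega> \<notin> bad n" "\<And>i. i \<in> {1..n} \<Longrightarrow> xs i \<omega> \<in> Xsp"
      and x: "x \<in> Xsp" "AE y in P\<^sub>Y\<^sub>X x. y \<in> Ysp" "\<And>i. i \<in> {1..n} \<Longrightarrow> fstar x + es i \<omega> \<in> Ysp"
    for n \<omega> x
  proof -
    have close: "norm (fstar x' - fhat n (D n \<omega>) x') \<le> \<kappa>1 n" if "x' \<in> Xsp" for x'
    proof -
      have "ennreal (norm (fstar x' - fhat n (D n \<omega>) x')) \<le> (SUP x\<in>Xsp. ennreal (norm (fstar x - fhat n (D n \<omega>) x)))"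
        using that by (rule SUP_upper)
      also have "\<dots> \<le> ennreal (\<kappa>1 n)" using \<omega> by (auto simp: bad_def)
      finally show ?thesis using \<kappa>1(1)[OF n] by (simp add: ennreal_le_iff)
    qed
    have "W0 n \<omega> < ennreal (\<kappa>2 n)" using \<omega> by (auto simp: bad_def)
    then obtain \<pi> where \<pi>: "\<pi> \<in> couplings (empirical n (\<lambda>i. fstar x0 + es i \<omega>)) (P\<^sub>Y\<^sub>X x0)"
        "(\<integral>\<^sup>+y. ennreal (norm (fst y - snd y) powr p) \<partial>\<pi>) \<le> ennreal (\<kappa>2 n powr p)"
      unfolding W0_def using p by (elim wasserstein_less_obtain) auto
    define pt where "pt i = closest_point Ysp (fhat n (D n \<omega>) x + residual fhat n (D n \<omega>) i)" for i
    have "norm (pt i - ((fstar x0 + es i \<omega>) + (fstar x - fstar x0))) \<le> 2 * \<kappa>1 n" if "i \<in> {1..n}" for i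
    proof -
      have "norm (pt i - (fstar x + (ys i \<omega> - fstar (xs i \<omega>)))) \<le> 2 * \<kappa>1 n"
        using close[OF x(1)] close[OF \<omega>(3)[OF that]] x(3)[OF that] unfolding pt_def assms(28,29)
        by (rule ER_atom_close[OF S that])
      then show ?thesis by (simp add: assms(28) algebra_simps)
    qed
    then have "wasserstein p (distr (P\<^sub>Y\<^sub>X x0) borel (\<lambda>y. y + (fstar x - fstar x0))) (empirical n pt)
        \<le> ennreal (2 * \<kappa>1 n + \<kappa>2 n)"
      using \<kappa>1(1)[OF n] \<kappa>2(1)[OF n] p n \<pi> by (intro wasserstein_translate_empirical_le) auto
    then have "wasserstein p (P\<^sub>Y\<^sub>X x) (ER_empirical Ysp fhat n (D n \<omega>) x) \<le> ennreal (\<zeta> n)"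
      unfolding ER_empirical_def \<zeta> P\<^sub>Y\<^sub>X pt_def[abs_def]
      by (subst cond_law_translate[of _ _ _ x x0]) auto
    then show ?thesis
      unfolding amb wasserstein_ball_def prob_measures_on_def using x prob_law sets_law by auto
  qed

  obtain H where H: "finite_Lq P\<^sub>X q H"
    "AE x in P\<^sub>X. \<forall>\<zeta> R Q. 0 < \<zeta> \<longrightarrow> \<zeta> \<le> 1 / 2 \<longrightarrow> R \<in> prob_measures_on Ysp \<longrightarrow>
      (\<integral>\<^sup>+y. ennreal (norm y powr p) \<partial>R) < \<top> \<longrightarrow>
      Q \<in> wasserstein_ball p Ysp R \<zeta> \<longrightarrow> P\<^sub>Y\<^sub>X x \<in> wasserstein_ball p Ysp R \<zeta> \<longrightarrow>
      ennreal (expected_cost c Ysp (zstar x) Q - expected_cost c Ysp (zstar x) (P\<^sub>Y\<^sub>X x)) \<le> H x * ennreal \<zeta>"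
    by (rule ex_cost_modulus[OF S(1,3) p q AE_z assms(39) assms(41) assms(52)])
  have [measurable]: "H \<in> borel_measurable P\<^sub>X" and "Lq_norm P\<^sub>X q H < \<top>" using H(1) by (auto simp: finite_Lq_def)
  define K where "K = enn2real (Lq_norm P\<^sub>X q H)"
  have K: "0 \<le> K" "Lq_norm P\<^sub>X q H = ennreal K"
    using \<open>Lq_norm P\<^sub>X q H < \<top>\<close> by (auto simp: K_def)

  have pointwise: "AE x in P\<^sub>X. ennreal \<bar>vDRO n \<omega> x - vstar x\<bar> \<le> H x * ennreal (\<zeta> n) \<and>
      ennreal \<bar>g (zDRO n \<omega> x) x - vstar x\<bar> \<le> H x * ennreal (\<zeta> n)"
    if n: "n \<ge> 1" "\<zeta> n \<le> 1 / 2" and \<omega>: "\<omega> \<in> space M" "\<omega> \<notin> bad n"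
      "\<forall>i. i \<ge> 1 \<longrightarrow> xs i \<omega> \<in> Xsp \<and> (AE x in P\<^sub>X. fstar x + es i \<omega> \<in> Ysp)" for n \<omega>
  proof -
    \<comment> \<open>For fixed data each index has its own null set of covariates; their countable
      union is null.\<close>
    have "AE x in P\<^sub>X. \<forall>i. i \<ge> 1 \<longrightarrow> fstar x + es i \<omega> \<in> Ysp"
      using \<omega>(3) by (auto simp: AE_all_countable)
    then show ?thesis
      using AE_X AE_law assms(24) H(2)
    proof eventually_elim
      case (elim x)
      have P: "P\<^sub>Y\<^sub>X x \<in> amb n \<omega> x"
        using elim \<omega> by (intro law_in_amb[OF n(1)]) auto
      note R = ER_empirical_properties[OF S(1,2) n(1)]
      have le: "ennreal (expected_cost c Ysp (zstar x) Q - expected_cost c Ysp (zstar x) (P\<^sub>Y\<^sub>X x)) \<le> H x * ennreal (\<zeta> n)"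
        if "Q \<in> amb n \<omega> x" for Q
        by (rule elim(5)[rule_format, OF \<zeta>_pos[OF n(1)] n(2) R that[unfolded amb] P[unfolded amb]])
      have zD: "is_arg_min (\<lambda>z. SUP Q\<in>amb n \<omega> x. expected_cost c Ysp z Q) (\<lambda>z. z \<in> Z) (zDRO n \<omega> x)"
        using assms(57)[OF n(1) \<omega>(1) elim(2)] unfolding worst_case_cost_def .
      have zs: "is_arg_min (\<lambda>z. expected_cost c Ysp z (P\<^sub>Y\<^sub>X x)) (\<lambda>z. z \<in> Z) (zstar x)"
        using elim(4) unfolding assms(18) .
      show ?case
        using worst_case_sandwich[OF P assms(54)[OF n(1) \<omega>(1) elim(2)] zD zs le]
        unfolding assms(18,21,56) worst_case_cost_def by simp
    qed
  qed

  \<comment> \<open>Stated for a general \<open>u\<close>, to be applied both to the DRO value and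
    to the true cost of the DRO solution.\<close>
  have bigO: "bigOp M (\<lambda>n \<omega>. Lq_norm P\<^sub>X q (\<lambda>x. ennreal \<bar>u n \<omega> x - vstar x\<bar>)) \<zeta>"
    if u: "\<And>n. n \<ge> 1 \<Longrightarrow> (\<lambda>(\<omega>, x). u n \<omega> x) \<in> borel_measurable (M \<Otimes>\<^sub>M P\<^sub>X)"
      and le: "\<And>n \<omega>. n \<ge> 1 \<Longrightarrow> \<zeta> n \<le> 1 / 2 \<Longrightarrow> \<omega> \<in> space M \<Longrightarrow> \<omega> \<notin> bad n \<Longrightarrow>
        \<forall>i. i \<ge> 1 \<longrightarrow> xs i \<omega> \<in> Xsp \<and> (AE x in P\<^sub>X. fstar x + es i \<omega> \<in> Ysp) \<Longrightarrow>
        AE x in P\<^sub>X. ennreal \<bar>u n \<omega> x - vstar x\<bar> \<le> H x * ennreal (\<zeta> n)" for u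
  proof (rule bigOp_of_AE_bound[OF assms(1) _ \<zeta>_pos K(1) _ bad_sets bad_le bad_lim])
    note [measurable] = assms(22)
    have uv: "(\<lambda>(\<omega>, x). ennreal \<bar>u n \<omega> x - vstar x\<bar>) \<in> borel_measurable (M \<Otimes>\<^sub>M P\<^sub>X)" if "n \<ge> 1" for n
      using u[OF that] unfolding case_prod_beta' by measurable
    then show "(\<lambda>\<omega>. Lq_norm P\<^sub>X q (\<lambda>x. ennreal \<bar>u n \<omega> x - vstar x\<bar>)) \<in> borel_measurable M" if "n \<ge> 1" for n
      using that by (intro borel_measurable_Lq_norm PX)
    \<comment> \<open>The modulus \<open>H\<close> is available only for radii up to
      \<open>1 / 2\<close>; boundedness in probability concerns large \<open>n\<close>, where this
      holds.\<close>
    have "\<forall>\<^sub>F n in sequentially. \<zeta> n < 1 / 2" by (rule order_tendstoD[OF assms(49)]) simp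
    then show "\<forall>\<^sub>F n in sequentially. AE \<omega> in M. \<omega> \<notin> bad n \<longrightarrow>
        Lq_norm P\<^sub>X q (\<lambda>x. ennreal \<bar>u n \<omega> x - vstar x\<bar>) \<le> ennreal K * ennreal (\<zeta> n)"
      using eventually_ge_at_top[of 1]
    proof eventually_elim
      case (elim n)
      then have n: "\<zeta> n \<le> 1 / 2" "1 \<le> n" by auto
      show ?case
        using AE_data AE_space
      proof eventually_elim
        case (elim \<omega>)
        show ?case
        proof
          assume "\<omega> \<notin> bad n"
          then have "AE x in P\<^sub>X. ennreal \<bar>u n \<omega> x - vstar x\<bar> \<le> H x * ennreal (\<zeta> n)"
            using elim n by (intro le)
          moreover have "(\<lambda>x. ennreal \<bar>u n \<omega> x - vstar x\<bar>) \<in> borel_measurable P\<^sub>X"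
            using measurable_Pair2[OF uv[OF n(2)] elim(2)] by simp
          ultimately show "Lq_norm P\<^sub>X q (\<lambda>x. ennreal \<bar>u n \<omega> x - vstar x\<bar>) \<le> ennreal K * ennreal (\<zeta> n)"
            unfolding K(2)[symmetric] using q \<zeta>_pos[OF n(2)] by (intro Lq_norm_le_mult) auto
        qed
      qed
    qed
  qed
  show ?thesis
    using pointwise by (intro conjI bigO assms(58,60)) (auto elim!: eventually_mono)
qed

end
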